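(* Let $\mathbb{H}$ be a cyclic interval hypergraph on $[n]$. If for every interval $D=[x,y]$ with $1\le x<y\le n$ the set $(\mathbb{H}|_D)_{\mathrm{reg}}$ of regular hyperedges of $\mathbb{H}|_D$ is closed under intersection (i.e. whenever $G,G'\in(\mathbb{H}|_D)_{\mathrm{reg}}$ satisfy $G\cap G'\ne\emptyset$, $G\cap G'$ is a hyperedge of $\mathbb{H}|_D$) and every hugging quadruple of $\mathbb{H}|_D$ has a fix, then the hypergraphic poset $P_{\mathbb{H}}$ is a lattice.
   Context: $[x,y]=\{x,\dots,y\}$, $[n]=[1,n]$. A hypergraph on $[x,y]$ is a set of nonempty subsets of $[x,y]$, by convention containing all singletons. A cyclic interval hypergraph on $[x,y]$ is one whose non-singleton hyperedges are regular, $[i,j]$ with $x\le i<j\le y$, $[i,j]\ne[x,y]$, or cyclic, $[j,y]\cup[x,i]$ with $x\le i<j\le y$ ($[x,y]$ counts as cyclic). For $D=[x,y]$, $\mathbb{H}|_D=\{H\cap D\mid H\in\mathbb{H}\}\setminus\{\emptyset\}$, regarded as a cyclic interval hypergraph on $[x,y]$. A hugging quadruple of a cyclic interval hypergraph on $[x,y]$ is a set of four distinct hyperedges $I,I_{\mathrm{cyc}},J,J_{\mathrm{cyc}}$ with $I,J$ regular, $I_{\mathrm{cyc}},J_{\mathrm{cyc}}$ cyclic, $\{x,x+1\}\subseteq I\cap I_{\mathrm{cyc}}$, $\{y-1,y\}\subseteq J\cap J_{\mathrm{cyc}}$; a fix is a hyperedge $K$ with $\{x+1,y-1\}\subseteq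 K\subseteq I\cup I_{\mathrm{cyc}}\cup J\cup J_{\mathrm{cyc}}$. An orientation $A$ of $\mathbb{H}$ assigns to each hyperedge $H$ a source $A(H)\in H$; it is cyclic if there are hyperedges $H_1,\dots,H_k$, $k\ge2$, with $A(H_{i+1})\in H_i\setminus\{A(H_i)\}$ ($i\in[k-1]$) and $A(H_1)\in H_k\setminus\{A(H_k)\}$, and acyclic otherwise. $P_{\mathbb{H}}$ is the set of acyclic orientations ordered by $A\le B$ iff $A(H)\le B(H)$ for all $H\in\mathbb{H}$ (equivalent to the hypergraphic poset from the oriented 1-skeleton of the hypergraphic polytope). *)

theory Defs
  imports "HOL-Library.FuncSet" "HOL-Algebra.Lattice"
begin

definition hypergraph_on :: "nat \<Rightarrow> nat \<Rightarrow> nat set set \<Rightarrow> bool" where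
  "hypergraph_on x y \<H> \<longleftrightarrow>
     (\<forall>H\<in>\<H>. H \<noteq> {} \<and> H \<subseteq> {x..y}) \<and> (\<forall>v\<in>{x..y}. {v} \<in> \<H>)"

definition regular_interval :: "nat \<Rightarrow> nat \<Rightarrow> nat set \<Rightarrow> bool" where
  "regular_interval x y H \<longleftrightarrow>
     (\<exists>i j. x \<le> i \<and> i < j \<and> j \<le> y \<and> H = {i..j} \<and> {i..j} \<noteq> {x..y})"

text \<open>For \<open>j = i + 1\<close> this is the whole interval, which therefore counts as cyclic.\<close>

definition cyclic_interval :: "nat \<Rightarrow> nat \<Rightarrow> nat set \<Rightarrow> bool" where
  "cyclic_interval x y H \<longleftrightarrow>
     (\<exists>i j. x \<le> i \<and> i < j \<and> j \<le> y \<and> H = {j..y} \<union> {x..i})"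

definition cyclic_interval_hypergraph :: "nat \<Rightarrow> nat \<Rightarrow> nat set set \<Rightarrow> bool" where
  "cyclic_interval_hypergraph x y \<H> \<longleftrightarrow>
     hypergraph_on x y \<H> \<and>
     (\<forall>H\<in>\<H>. (\<exists>v. H = {v}) \<or> regular_interval x y H \<or> cyclic_interval x y H)"

definition restriction :: "nat set set \<Rightarrow> nat set \<Rightarrow> nat set set" where
  "restriction \<H> D = {H \<inter> D | H. H \<in> \<H>} - {{}}"

definition regular_hyperedges :: "nat \<Rightarrow> nat \<Rightarrow> nat set set \<Rightarrow> nat set set" where
  "regular_hyperedges x y \<H> = {H \<in> \<H>. regular_interval x y H}"

definition cyclic_hyperedges :: "nat \<Rightarrow> nat \<Rightarrow> nat set set \<Rightarrow> nat set set" where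
  "cyclic_hyperedges x y \<H> = {H \<in> \<H>. cyclic_interval x y H}"

definition regular_closed_under_intersection :: "nat \<Rightarrow> nat \<Rightarrow> nat set set \<Rightarrow> bool" where
  "regular_closed_under_intersection x y \<H> \<longleftrightarrow>
     (\<forall>G\<in>regular_hyperedges x y \<H>. \<forall>G'\<in>regular_hyperedges x y \<H>.
        G \<inter> G' \<noteq> {} \<longrightarrow> G \<inter> G' \<in> \<H>)"

text \<open>The two definitions below are only meant for \<open>x < y\<close>, so that \<open>y - 1\<close> is not truncated.\<close>

definition hugging_quadruple ::
  "nat \<Rightarrow> nat \<Rightarrow> nat set set \<Rightarrow> nat set \<Rightarrow> nat set \<Rightarrow> nat set \<Rightarrow> nat set \<Rightarrow> bool" where
  "hugging_quadruple x y \<H> I Icyc J Jcyc \<longleftrightarrow>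
     distinct [I, Icyc, J, Jcyc] \<and>
     I \<in> regular_hyperedges x y \<H> \<and> J \<in> regular_hyperedges x y \<H> \<and>
     Icyc \<in> cyclic_hyperedges x y \<H> \<and> Jcyc \<in> cyclic_hyperedges x y \<H> \<and>
     {x, x + 1} \<subseteq> I \<inter> Icyc \<and> {y - 1, y} \<subseteq> J \<inter> Jcyc"

definition is_fix ::
  "nat \<Rightarrow> nat \<Rightarrow> nat set set \<Rightarrow> nat set \<Rightarrow> nat set \<Rightarrow> nat set \<Rightarrow> nat set \<Rightarrow> nat set \<Rightarrow> bool" where
  "is_fix x y \<H> I Icyc J Jcyc K \<longleftrightarrow>
     K \<in> \<H> \<and> {x + 1, y - 1} \<subseteq> K \<and> K \<subseteq> I \<union> Icyc \<union> J \<union> Jcyc"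

text \<open>Orientations are extensional functions, so that two orientations that agree on all
  hyperedges are equal.\<close>

definition orientations :: "nat set set \<Rightarrow> (nat set \<Rightarrow> nat) set" where
  "orientations \<H> = (\<Pi>\<^sub>E H\<in>\<H>. H)"

definition cyclic_orientation :: "nat set set \<Rightarrow> (nat set \<Rightarrow> nat) \<Rightarrow> bool" where
  "cyclic_orientation \<H> A \<longleftrightarrow>
     (\<exists>k\<ge>2. \<exists>E :: nat \<Rightarrow> nat set.
        (\<forall>i\<in>{1..k}. E i \<in> \<H>) \<and>
        (\<forall>i\<in>{1..k-1}. A (E (i + 1)) \<in> E i - {A (E i)}) \<and>
        A (E 1) \<in> E k - {A (E k)})"

definition acyclic_orientations :: "nat set set \<Rightarrow> (nat set \<Rightarrow> nat) set" where
  "acyclic_orientations \<H> = {A \<in> orientations \<H>. \<not> cyclic_orientation \<H> A}"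

definition hypergraphic_poset :: "nat set set \<Rightarrow> (nat set \<Rightarrow> nat) gorder" where
  "hypergraphic_poset \<H> =
     \<lparr>carrier = acyclic_orientations \<H>, eq = (=), le = (\<lambda>A B. \<forall>H\<in>\<H>. A H \<le> B H)\<rparr>"

lemma restriction_cyclic_interval_hypergraph:
  assumes "cyclic_interval_hypergraph 1 n \<H>" "1 \<le> x" "y \<le> n"
  shows "cyclic_interval_hypergraph x y (restriction \<H> {x..y})"
proof -
  have hyp: "hypergraph_on 1 n \<H>"
    and shape: "\<And>H. H \<in> \<H> \<Longrightarrow> (\<exists>v. H = {v}) \<or> regular_interval 1 n H \<or> cyclic_interval 1 n H"
    using assms(1) by (auto simp: cyclic_interval_hypergraph_def)
  have ivl: "(\<exists>v. {a..b} = {v}) \<or> regular_interval x y {a..b} \<or> cyclic_interval x y {a..b}"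
    if "x \<le> a" "a \<le> b" "b \<le> y" for a b
  proof (cases "a = b")
    case False
    show ?thesis
    proof (cases "{a..b} = {x..y}")
      case True
      with False that have "x \<le> x \<and> x < Suc x \<and> Suc x \<le> y \<and> {a..b} = {Suc x..y} \<union> {x..x}"
        by auto
      then show ?thesis unfolding cyclic_interval_def by blast
    next
      case neq: False
      then show ?thesis using False that unfolding regular_interval_def
        by (metis le_neq_implies_less)
    qed
  qed auto
  have "(\<exists>v. H \<inter> {x..y} = {v}) \<or> regular_interval x y (H \<inter> {x..y}) \<or> cyclic_interval x y (H \<inter> {x..y})"
    if H: "H \<in> \<H>" and ne: "H \<inter> {x..y} \<noteq> {}" for H
  proof -
    consider v where "H = {v}" | i j where "H = {i..j}"
      | i j where "1 \<le> i" "i < j" "j \<le> n" "H = {j..n} \<union> {1..i}"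
      using shape[OF H] by (auto simp: regular_interval_def cyclic_interval_def)
    then show ?thesis
    proof cases
      case 1
      then show ?thesis using ne by auto
    next
      case 2
      then have eq: "H \<inter> {x..y} = {max i x..min j y}" by auto
      with ne have "max i x \<le> min j y" by auto
      with ivl[of "max i x" "min j y"] show ?thesis unfolding eq by auto
    next
      case 3
      have eq: "H \<inter> {x..y} = {max j x..y} \<union> {x..min i y}" using 3 assms by auto
      consider "x \<le> i" "j \<le> y" | "i < x" | "y < j" by linarith
      then show ?thesis
      proof cases
        case 1
        then have "cyclic_interval x y (H \<inter> {x..y})"
          unfolding cyclic_interval_def eq using 3 by (intro exI[of _ i] exI[of _ j]) auto
        then show ?thesis by blast
      next
        case 2
        then have "H \<inter> {x..y} = {max j x..y}" using eq by auto
        with ivl[of "max j x" y] ne show ?thesis by auto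
      next
        case 3
        then have "H \<inter> {x..y} = {x..min i y}" using eq by auto
        with ivl[of x "min i y"] ne show ?thesis by auto
      qed
    qed
  qed
  moreover have "{v} \<in> restriction \<H> {x..y}" if "v \<in> {x..y}" for v
  proof -
    have "{v} \<in> \<H>" using hyp that assms by (auto simp: hypergraph_on_def)
    moreover have "{v} = {v} \<inter> {x..y}" using that by auto
    ultimately show ?thesis unfolding restriction_def by blast
  qed
  ultimately show ?thesis
    unfolding cyclic_interval_hypergraph_def hypergraph_on_def by (auto simp: restriction_def)
qed

end

theory Submission
  imports Defs
begin

text \<open>
  Let \<open>M\<close> be the pointwise maximum of a set of acyclic orientations. Any acyclic orientation above
  \<open>M\<close> comes from a linear order in which a vertex \<open>v\<close> may be listed as soon as every hyperedge
  \<open>G\<close> containing \<open>v\<close> with \<open>M G > v\<close> has been met. Listing greedily outside \<open>H\<close> therefore computes the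
  least possible source \<open>J H\<close> of \<open>H\<close> among all acyclic upper bounds, and the join exists iff \<open>J\<close> is
  acyclic. Since hyperedges are arcs of a circle, a shortest cycle of \<open>J\<close> either has length two or
  winds once around the circle. Winding cycles are excluded by comparing the greedy sets of the
  hyperedges involved. In a cycle of length two, the hyperedge that keeps the smaller source from
  being listed wraps around and gives rise to a hugging quadruple, and a fix of it produces a cycle
  of length at most three in one of the given orientations. Meets are joins of sets of lower bounds.
\<close>

section \<open>Orientations as precedence relations\<close>

definition precedence :: "nat set set \<Rightarrow> (nat set \<Rightarrow> nat) \<Rightarrow> nat rel" where
  "precedence E A = {(A H, w) | H w. H \<in> E \<and> w \<in> H \<and> w \<noteq> A H}"

lemma precedenceI: "H \<in> E \<Longrightarrow> w \<in> H \<Longrightarrow> w \<noteq> A H \<Longrightarrow> (A H, w) \<in> precedence E A"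
  unfolding precedence_def by blast

lemma precedenceE:
  assumes "(v, w) \<in> precedence E A"
  obtains H where "H \<in> E" "v = A H" "w \<in> H" "w \<noteq> v"
  using assms unfolding precedence_def by blast

text \<open>The hyperedges of a cycle correspond to the steps of a closed walk through their
  sources, so cycles can be treated by transitive closures.\<close>

lemma cyclic_orientation_iff: "cyclic_orientation E A \<longleftrightarrow> \<not> acyclic (precedence E A)"
proof
  assume "cyclic_orientation E A"
  then obtain k :: nat and F where k: "k \<ge> 2" and F: "\<And>i. i \<in> {1..k} \<Longrightarrow> F i \<in> E"
    and next_in: "\<And>i. i \<in> {1..k-1} \<Longrightarrow> A (F (i + 1)) \<in> F i - {A (F i)}"
    and last: "A (F 1) \<in> F k - {A (F k)}"
    unfolding cyclic_orientation_def by blast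
  have reach: "(A (F 1), A (F i)) \<in> (precedence E A)\<^sup>*" if "1 \<le> i" "i \<le> k" for i
    using that
  proof (induction i rule: dec_induct)
    case (step i)
    then have "i \<in> {1..k}" "i \<in> {1..k-1}" by auto
    then have "(A (F i), A (F (Suc i))) \<in> precedence E A"
      using F[of i] next_in[of i] by (intro precedenceI) auto
    moreover have "(A (F 1), A (F i)) \<in> (precedence E A)\<^sup>*" using step by simp
    ultimately show ?case by (rule rtrancl.rtrancl_into_rtrancl[rotated])
  qed simp
  have "(A (F k), A (F 1)) \<in> precedence E A"
    using F[of k] last k by (auto intro!: precedenceI)
  with reach[of k] k have "(A (F 1), A (F 1)) \<in> (precedence E A)\<^sup>+" by auto
  then show "\<not> acyclic (precedence E A)" unfolding acyclic_def by blast
next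
  assume "\<not> acyclic (precedence E A)"
  then obtain v where "(v, v) \<in> (precedence E A)\<^sup>+" unfolding acyclic_def by blast
  then obtain k where k: "k > 0" "(v, v) \<in> precedence E A ^^ k" by (auto simp: trancl_power)
  then obtain f where f: "f 0 = v" "f k = v" "\<And>i. i < k \<Longrightarrow> (f i, f (Suc i)) \<in> precedence E A"
    by (auto simp: relpow_fun_conv)
  have "\<forall>i. \<exists>H. i < k \<longrightarrow> H \<in> E \<and> f i = A H \<and> f (Suc i) \<in> H \<and> f (Suc i) \<noteq> f i"
  proof
    fix i
    show "\<exists>H. i < k \<longrightarrow> H \<in> E \<and> f i = A H \<and> f (Suc i) \<in> H \<and> f (Suc i) \<noteq> f i"
      using f(3)[of i] by (cases "i < k") (auto elim!: precedenceE)
  qed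
  then obtain X where X: "\<And>i. i < k \<Longrightarrow> X i \<in> E \<and> f i = A (X i) \<and> f (Suc i) \<in> X i \<and> f (Suc i) \<noteq> f i"
    by metis
  \<comment> \<open>A walk with one step would be a loop, which \<open>precedence\<close> excludes;
    hence the required \<open>k \<ge> 2\<close>.\<close>
  have "k \<noteq> 1" using X[of 0] f by auto
  then have k2: "k \<ge> 2" using k by auto
  define F where "F i = X (i - 1)" for i
  have "F i \<in> E" if "i \<in> {1..k}" for i using X[of "i - 1"] that unfolding F_def by auto
  moreover have "A (F (i + 1)) \<in> F i - {A (F i)}" if "i \<in> {1..k-1}" for i
  proof -
    from that have "i - 1 < k" "i < k" "Suc (i - 1) = i" by auto
    with X[of "i - 1"] X[of i] show ?thesis unfolding F_def by auto
  qed
  moreover have "A (F 1) \<in> F k - {A (F k)}"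
    using X[of "k - 1"] X[of 0] k2 f unfolding F_def by auto
  ultimately show "cyclic_orientation E A"
    unfolding cyclic_orientation_def using k2 by blast
qed

lemma acyclic_orientations_iff:
  "A \<in> acyclic_orientations E \<longleftrightarrow> A \<in> orientations E \<and> acyclic (precedence E A)"
  unfolding acyclic_orientations_def by (simp add: cyclic_orientation_iff)

lemma acyclic_no_2_cycle:
  assumes "acyclic (precedence E A)" "H \<in> E" "G \<in> E" "A H \<in> G" "A G \<in> H"
  shows "A H = A G"
proof (rule ccontr)
  assume "A H \<noteq> A G"
  then have "(A H, A G) \<in> precedence E A" "(A G, A H) \<in> precedence E A"
    using assms by (auto intro!: precedenceI)
  then have "(A H, A H) \<in> (precedence E A)\<^sup>+" by (rule trancl.trancl_into_trancl[OF trancl.r_into_trancl])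
  then show False using assms(1) unfolding acyclic_def by blast
qed

text \<open>Only the step from \<open>A G\<close> to \<open>A H\<close> has to be proper. The other
  two sources may coincide with a neighbour, which merely shortens the cycle.\<close>

lemma acyclic_no_3_cycle:
  assumes "acyclic (precedence E A)" "H \<in> E" "G \<in> E" "K \<in> E"
    and "A H \<in> G" "A H \<noteq> A G" "A G \<in> K" "A K \<in> H"
  shows False
proof -
  let ?R = "precedence E A"
  have "(A G, A H) \<in> ?R" using assms by (auto intro!: precedenceI)
  moreover have "(A H, A K) \<in> ?R\<^sup>*"
    using precedenceI[of H E "A K" A] assms by (cases "A H = A K") auto
  moreover have "(A K, A G) \<in> ?R\<^sup>*"
    using precedenceI[of K E "A G" A] assms by (cases "A K = A G") auto
  ultimately have "(A G, A G) \<in> ?R\<^sup>+"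
    by (meson rtrancl_into_trancl2 trancl_rtrancl_trancl)
  then show False using assms(1) unfolding acyclic_def by blast
qed

section \<open>Least upper bounds of sources\<close>

text \<open>\<open>S\<close> is the set of vertices already listed. If \<open>v\<close> is listed
  next, it becomes the source of every hyperedge \<open>G\<close> containing it that
  \<open>S\<close> has not met, so \<open>M G \<le> v\<close> is required of these.\<close>

definition available :: "nat set set \<Rightarrow> (nat set \<Rightarrow> nat) \<Rightarrow> nat set \<Rightarrow> nat \<Rightarrow> bool" where
  "available E M S v \<longleftrightarrow> (\<forall>G\<in>E. v \<in> G \<longrightarrow> M G \<le> v \<or> (\<exists>w. w \<in> G \<and> w \<in> S))"

text \<open>Vertices that can be listed before every vertex of \<open>X\<close> in a linear order all of whose
  sources are bounded below by \<open>M\<close>.\<close>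

inductive_set early :: "nat \<Rightarrow> nat set set \<Rightarrow> (nat set \<Rightarrow> nat) \<Rightarrow> nat set \<Rightarrow> nat set"
  for n E M X where
  earlyI: "v \<in> {1..n} \<Longrightarrow> v \<notin> X \<Longrightarrow>
    \<forall>G\<in>E. v \<in> G \<longrightarrow> M G \<le> v \<or> (\<exists>w. w \<in> G \<and> w \<in> early n E M X) \<Longrightarrow> v \<in> early n E M X"

definition least_source :: "nat \<Rightarrow> nat set set \<Rightarrow> (nat set \<Rightarrow> nat) \<Rightarrow> nat set \<Rightarrow> nat" where
  "least_source n E M H = (LEAST v. v \<in> H \<and> available E M (early n E M H) v)"

section \<open>Hyperedges as arcs of a circle\<close>

locale arc_hypergraph =
  fixes n :: nat and E :: "nat set set"
  assumes edge_subset: "H \<in> E \<Longrightarrow> H \<subseteq> {1..n}"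
    and edge_nonempty: "H \<in> E \<Longrightarrow> H \<noteq> {}"
    and arc: "H \<in> E \<Longrightarrow> u \<in> H \<Longrightarrow> w \<in> H \<Longrightarrow> u < w \<Longrightarrow> {u..w} \<subseteq> H \<or> {1..u} \<union> {w..n} \<subseteq> H"
begin

lemma edge_range: "H \<in> E \<Longrightarrow> v \<in> H \<Longrightarrow> 1 \<le> v \<and> v \<le> n"
  using edge_subset by fastforce

text \<open>The alternatives in \<open>arc\<close> are the two arcs of the circle between
  \<open>u\<close> and \<open>w\<close>. The missed vertex \<open>v\<close> rules out the inner
  one.\<close>

lemma arc_below_gap:
  assumes "H \<in> E" "u \<in> H" "w \<in> H" "v \<notin> H" "u < v" "v < w" "1 \<le> x" "x \<le> u"
  shows "x \<in> H"
proof -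
  have "v \<in> {u..w}" "x \<in> {1..u}" using assms by auto
  then show ?thesis using arc[of H u w] assms by (meson UnI1 less_trans subsetD)
qed

lemma arc_above_gap:
  assumes "H \<in> E" "u \<in> H" "w \<in> H" "v \<notin> H" "u < v" "v < w" "w \<le> x" "x \<le> n"
  shows "x \<in> H"
proof -
  have "v \<in> {u..w}" "x \<in> {w..n}" using assms by auto
  then show ?thesis using arc[of H u w] assms by (meson UnI2 less_trans subsetD)
qed

lemma arc_between:
  assumes "H \<in> E" "u \<in> H" "w \<in> H" "u \<le> v" "v \<le> w" "x \<notin> H" "1 \<le> x" "x \<le> n" "x < u \<or> w < x"
  shows "v \<in> H"
proof (rule ccontr)
  assume v: "v \<notin> H"
  then have "u < v" "v < w" using assms by (metis le_neq_implies_less)+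
  then show False
    using arc_below_gap[of H u w v x] arc_above_gap[of H u w v x] v assms by auto
qed

text \<open>No \<open>Y i\<close> contains a third vertex of the cycle. The outer arc between
  \<open>q i\<close> and \<open>q (Suc i)\<close> would contain \<open>q 0\<close>, or
  \<open>q (m - 1)\<close> if \<open>i = 0\<close>, so \<open>Y i\<close> contains the inner
  segment. A later \<open>q j\<close> inside this segment would again be a third vertex, which gives
  monotonicity. The last hyperedge wraps around because its inner segment would contain
  \<open>q 1\<close>.\<close>

lemma winding_cycle_shape:
  assumes m: "3 \<le> m" and Y: "\<And>i. i < m \<Longrightarrow> Y i \<in> E"
    and this_in: "\<And>i. i < m \<Longrightarrow> q i \<in> Y i" and next_in: "\<And>i. Suc i < m \<Longrightarrow> q (Suc i) \<in> Y i"
    and last_in: "q 0 \<in> Y (m - 1)"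
    and only: "\<And>i j. i < m \<Longrightarrow> j < m \<Longrightarrow> q j \<in> Y i \<Longrightarrow> j = i \<or> j = Suc i \<or> (Suc i = m \<and> j = 0)"
    and min: "\<And>j. 0 < j \<Longrightarrow> j < m \<Longrightarrow> q 0 < q j"
    and inj: "\<And>i j. i < j \<Longrightarrow> j < m \<Longrightarrow> q i \<noteq> q j"
    and direction: "q 1 < q (m - 1)"
  shows "\<And>i j. i < j \<Longrightarrow> j < m \<Longrightarrow> q i < q j"
    and "\<And>i. Suc i < m \<Longrightarrow> {q i..q (Suc i)} \<subseteq> Y i"
    and "{1..q 0} \<union> {q (m - 1)..n} \<subseteq> Y (m - 1)"
proof -
  have q_range: "1 \<le> q i" "q i \<le> n" if "i < m" for i using edge_range[OF Y this_in] that by auto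
  have seg: "{q i..q (Suc i)} \<subseteq> Y i" if i: "Suc i < m" and lt: "q i < q (Suc i)" for i
  proof (rule ccontr)
    assume "\<not> ?thesis"
    then have sub: "{1..q i} \<union> {q (Suc i)..n} \<subseteq> Y i"
      using arc[OF Y this_in next_in lt] i by auto
    show False
    proof (cases "i = 0")
      case True
      then have "q (m - 1) \<in> Y 0" using sub direction q_range[of "m - 1"] m by auto
      then show False using only[of 0 "m - 1"] m by auto
    next
      case False
      then have "q 0 \<in> Y i" using sub min[of i] q_range[of 0] i by auto
      then show False using only[of i 0] i False by auto
    qed
  qed
  have mono: "\<forall>j. i < j \<longrightarrow> j < m \<longrightarrow> q i < q j" for i
  proof (induction i)
    case 0
    then show ?case using min by auto
  next
    case (Suc i)
    show ?case
    proof (intro allI impI)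
      fix j assume j: "Suc i < j" "j < m"
      have lt: "q i < q (Suc i)" "q i < q j" using Suc j by auto
      have "\<not> q j < q (Suc i)"
      proof
        assume "q j < q (Suc i)"
        then have "q j \<in> Y i" using seg[of i] lt j by auto
        then show False using only[of i j] j by auto
      qed
      then show "q (Suc i) < q j" using inj[OF j] by auto
    qed
  qed
  then show "\<And>i j. i < j \<Longrightarrow> j < m \<Longrightarrow> q i < q j" by blast
  from mono seg show "\<And>i. Suc i < m \<Longrightarrow> {q i..q (Suc i)} \<subseteq> Y i" by blast
  have "\<not> {q 0..q (m - 1)} \<subseteq> Y (m - 1)"
  proof
    assume sub: "{q 0..q (m - 1)} \<subseteq> Y (m - 1)"
    have "q 1 \<in> {q 0..q (m - 1)}" using min[of 1] direction m by auto
    then have "q 1 \<in> Y (m - 1)" using sub by blast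
    then show False using only[of "m - 1" 1] m by auto
  qed
  then show "{1..q 0} \<union> {q (m - 1)..n} \<subseteq> Y (m - 1)"
    using arc[OF Y[of "m - 1"] last_in this_in[of "m - 1"]] min[of "m - 1"] m by auto
qed

end

section \<open>Greedy sets and the least source of a hyperedge\<close>

locale source_bound = arc_hypergraph +
  fixes M :: "nat set \<Rightarrow> nat"
  assumes bound_in: "G \<in> E \<Longrightarrow> M G \<in> G"
begin

abbreviation "S \<equiv> early n E M"
abbreviation "J \<equiv> least_source n E M"

lemma early_iff: "v \<in> S X \<longleftrightarrow> v \<in> {1..n} \<and> v \<notin> X \<and> available E M (S X) v"
  unfolding available_def by (subst early.simps) blast

lemma available_mono: "available E M T v \<Longrightarrow> T \<subseteq> T' \<Longrightarrow> available E M T' v"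
  unfolding available_def by blast

text \<open>The largest vertex outside \<open>S H\<close> is available: a hyperedge missed by
  \<open>S H\<close> has its bound outside \<open>S H\<close>, hence not above this vertex.
  Available but not listed, it must lie in \<open>H\<close>.\<close>

lemma ex_available:
  assumes "H \<in> E" shows "\<exists>v. v \<in> H \<and> available E M (S H) v"
proof -
  let ?R = "{1..n} - S H"
  define v where "v = Max ?R"
  have ne: "?R \<noteq> {}" using edge_subset[OF assms] edge_nonempty[OF assms] early_iff by blast
  then have v: "v \<in> ?R" unfolding v_def by (intro Max_in) auto
  have "available E M (S H) v"
    unfolding available_def
  proof (intro ballI impI)
    fix G assume G: "G \<in> E" "v \<in> G"
    show "M G \<le> v \<or> (\<exists>w. w \<in> G \<and> w \<in> S H)"
    proof (cases "G \<inter> S H = {}")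
      case True
      then have "M G \<in> ?R" using bound_in[OF G(1)] edge_subset[OF G(1)] by blast
      then show ?thesis unfolding v_def by simp
    qed blast
  qed
  with v show ?thesis by (metis DiffD1 DiffD2 early_iff)
qed

lemma J_props: "H \<in> E \<Longrightarrow> J H \<in> H \<and> available E M (S H) (J H)"
  unfolding least_source_def by (rule LeastI_ex) (rule ex_available)

lemmas J_in = J_props[THEN conjunct1] and J_available = J_props[THEN conjunct2]

lemma J_le: "v \<in> H \<Longrightarrow> available E M (S H) v \<Longrightarrow> J H \<le> v"
  unfolding least_source_def by (rule Least_le) simp

lemma early_not_in: "v \<in> S H \<Longrightarrow> v \<notin> H" and early_range: "v \<in> S H \<Longrightarrow> 1 \<le> v \<and> v \<le> n"
  using early_iff by auto

text \<open>As \<open>S H\<close> has not met \<open>G\<close>, availability of \<open>J H\<close>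
  can only be due to the bound of \<open>G\<close>.\<close>

lemma bound_le_J_of_disjoint:
  "H \<in> E \<Longrightarrow> G \<in> E \<Longrightarrow> J H \<in> G \<Longrightarrow> G \<inter> S H = {} \<Longrightarrow> M G \<le> J H"
  using J_available[of H] unfolding available_def by blast

lemma bound_le_J_of_subset: "H \<in> E \<Longrightarrow> G \<in> E \<Longrightarrow> J H \<in> G \<Longrightarrow> G \<subseteq> H \<Longrightarrow> M G \<le> J H"
  by (rule bound_le_J_of_disjoint) (auto dest: early_not_in)

lemma bound_le_J: "H \<in> E \<Longrightarrow> M H \<le> J H"
  using bound_le_J_of_subset[of H H] J_in by blast

text \<open>The listing for \<open>H\<close> can be repeated for \<open>H'\<close> until it enters
  \<open>H'\<close>. A first vertex there would be available for \<open>H'\<close>, hence at least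
  \<open>J H'\<close>.\<close>

lemma early_subset:
  assumes "\<And>s. s \<in> S H \<Longrightarrow> s \<in> H' \<Longrightarrow> s < J H'"
  shows "S H \<subseteq> S H'"
proof
  fix v assume "v \<in> S H"
  then show "v \<in> S H'"
  proof (induction rule: early.induct)
    case (earlyI v)
    then have av: "available E M (S H') v" unfolding available_def by blast
    have "v \<in> S H" using earlyI by (auto intro!: early.earlyI)
    then have "v \<notin> H'" using assms J_le[OF _ av] by fastforce
    then show ?case using av earlyI by (simp add: early_iff)
  qed
qed

text \<open>The first vertex of \<open>Y\<close> to be listed cannot rely on an earlier one in
  \<open>Y\<close>, so it is at least \<open>M Y\<close>.\<close>

lemma early_hit:
  assumes "Y \<in> E" "v \<in> S X" "v \<in> Y"
  obtains t where "t \<in> S X" "t \<in> Y" "M Y \<le> t"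
proof -
  have "v \<in> Y \<longrightarrow> (\<exists>t. t \<in> S X \<and> t \<in> Y \<and> M Y \<le> t)"
    using assms(2)
  proof (induction rule: early.induct)
    case (earlyI v)
    then have "v \<in> S X" by (auto intro!: early.earlyI)
    with earlyI assms(1) show ?case by blast
  qed
  with assms(3) that show ?thesis by blast
qed

text \<open>If \<open>G\<close> contains \<open>v\<close> and \<open>M G > v\<close>, then
  \<open>C G\<close> differs from \<open>v\<close> and comes before it. So whatever must be met
  before \<open>C H\<close> is met by predecessors of \<open>C H\<close>, and \<open>C H\<close> is
  available.\<close>

lemma J_least:
  assumes "C \<in> acyclic_orientations E" "\<And>H. H \<in> E \<Longrightarrow> M H \<le> C H" "H \<in> E"
  shows "J H \<le> C H"
proof -
  let ?R = "precedence E C"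
  have C: "\<And>G. G \<in> E \<Longrightarrow> C G \<in> G" and ac: "acyclic ?R"
    using assms(1) by (auto simp: acyclic_orientations_iff orientations_def)
  have "?R \<subseteq> {1..n} \<times> {1..n}" using C edge_subset unfolding precedence_def by blast
  then have "finite ?R" using finite_subset by blast
  then have wf: "wf ?R" using ac by (rule finite_acyclic_wf)
  have block: "(C G, v) \<in> ?R" if "G \<in> E" "v \<in> G" "\<not> M G \<le> v" for G v
    using that assms(2)[of G] by (intro precedenceI) auto
  \<comment> \<open>The vertices that \<open>C\<close> forces before \<open>C H\<close> avoid \<open>H\<close>, so the greedy procedure lists them.\<close>
  have pred: "(v, C H) \<in> ?R\<^sup>+ \<longrightarrow> v \<in> S H" for v
  proof (induction v rule: wf_induct[OF wf])
    case (1 v)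
    show ?case
    proof
      assume v: "(v, C H) \<in> ?R\<^sup>+"
      have "v \<notin> H"
      proof
        assume "v \<in> H"
        then have "(C H, v) \<in> ?R\<^sup>*"
          using assms(3) by (cases "v = C H") (auto intro: precedenceI r_into_rtrancl)
        with v have "(C H, C H) \<in> ?R\<^sup>+" by auto
        then show False using ac unfolding acyclic_def by blast
      qed
      moreover have "v \<in> {1..n}"
      proof -
        obtain w where "(v, w) \<in> ?R" using v by (meson tranclD)
        then show ?thesis using C edge_subset unfolding precedence_def by blast
      qed
      moreover have "available E M (S H) v"
        unfolding available_def
      proof (intro ballI impI)
        fix G assume G: "G \<in> E" "v \<in> G"
        show "M G \<le> v \<or> (\<exists>w. w \<in> G \<and> w \<in> S H)"
        proof (cases "M G \<le> v")
          case False
          with block[OF G] have R: "(C G, v) \<in> ?R" by simp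
          with v have "(C G, C H) \<in> ?R\<^sup>+" by (rule trancl_into_trancl2[rotated])
          with 1 R C[OF G(1)] show ?thesis by blast
        qed simp
      qed
      ultimately show "v \<in> S H" by (simp add: early_iff)
    qed
  qed
  have "available E M (S H) (C H)"
    unfolding available_def using block pred C by blast
  then show ?thesis using C assms(3) by (intro J_le)
qed

text \<open>The set \<open>S ?L\<close> stays below \<open>q (m - 1)\<close> and is carried
  backwards along the cycle into every \<open>S (Y i)\<close> by \<open>early_subset\<close>. At
  \<open>i = 0\<close> this makes \<open>q 0 = J ?L\<close> available for \<open>Y 0\<close>,
  although \<open>J (Y 0) = q 1\<close> is larger.\<close>

lemma no_descending_winding_cycle:
  assumes m: "3 \<le> m" and Y: "\<And>i. i < m \<Longrightarrow> Y i \<in> E"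
    and mono: "\<And>i j. i < j \<Longrightarrow> j < m \<Longrightarrow> q i < q j"
    and seg: "\<And>i. Suc i < m \<Longrightarrow> {q i..q (Suc i)} \<subseteq> Y i"
    and wrap: "{1..q 0} \<union> {q (m - 1)..n} \<subseteq> Y (m - 1)"
    and only: "\<And>i j. i < m \<Longrightarrow> j < m \<Longrightarrow> q j \<in> Y i \<Longrightarrow> j = i \<or> j = Suc i \<or> (Suc i = m \<and> j = 0)"
    and J: "\<And>i. Suc i < m \<Longrightarrow> J (Y i) = q (Suc i)" "J (Y (m - 1)) = q 0"
  shows False
proof -
  let ?L = "Y (m - 1)"
  have L: "?L \<in> E" using m by (intro Y) simp
  have q0: "1 \<le> q 0" using J_in[OF L] J(2) edge_subset[OF L] by auto
  have top: "s < q (m - 1)" if "s \<in> S ?L" for s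
    using that early_not_in[OF that] early_range[OF that] wrap by fastforce
  have far: "q (Suc (Suc i)) < s"
    if "S ?L \<subseteq> S (Y (Suc i))" "s \<in> S ?L" "q (Suc i) \<le> s" "Suc (Suc i) < m" for i s
  proof -
    have "s \<notin> Y (Suc i)" using that early_not_in by blast
    then show ?thesis using seg[of "Suc i"] that by fastforce
  qed
  have gap: "q (Suc (Suc i)) \<notin> Y i" "q (Suc i) \<in> Y i" if "Suc (Suc i) < m" for i
  proof -
    show "q (Suc (Suc i)) \<notin> Y i" using only[of i "Suc (Suc i)"] that by auto
    have "q (Suc i) \<in> {q i..q (Suc i)}" using mono[of i "Suc i"] that by auto
    then show "q (Suc i) \<in> Y i" using seg[of i] that by auto
  qed
  have "S ?L \<subseteq> S (Y i)" if "i \<le> m - 2" "1 \<le> i" for i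
    using that
  proof (induction rule: inc_induct)
    case base
    have "J (Y (m - 2)) = q (m - 1)" using J(1)[of "m - 2"] m by (simp add: numeral_2_eq_2 Suc_diff_Suc)
    then show ?case using top by (intro early_subset) auto
  next
    case (step i)
    then have i: "Suc (Suc i) < m" by auto
    show ?case
    proof (rule early_subset)
      fix s assume s: "s \<in> S ?L" "s \<in> Y i"
      show "s < J (Y i)"
      proof (rule ccontr)
        assume "\<not> ?thesis"
        then have le: "q (Suc i) \<le> s" using J(1)[of i] i by simp
        \<comment> \<open>\<open>Y i\<close> misses \<open>q (Suc (Suc i))\<close> but contains
          vertices on both sides of it, so it reaches down to \<open>q 0\<close>.\<close>
        have "q (Suc (Suc i)) < s" using far[OF _ s(1) le i] step by auto
        moreover have "q 0 \<le> q (Suc i)" using mono[of 0 "Suc i"] i by auto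
        ultimately have "q 0 \<in> Y i"
          using arc_below_gap[OF Y gap(2)[OF i] s(2) gap(1)[OF i], of "q 0"] mono[of "Suc i" "Suc (Suc i)"] i q0
          by auto
        then show False using only[of i 0] step i by auto
      qed
    qed
  qed
  from this[of 1] have L1: "S ?L \<subseteq> S (Y (Suc 0))" using m by auto
  have "S ?L \<subseteq> S (Y 0)"
  proof (rule early_subset)
    fix s assume s: "s \<in> S ?L" "s \<in> Y 0"
    have i: "Suc (Suc 0) < m" using m by simp
    show "s < J (Y 0)"
    proof (rule ccontr)
      assume "\<not> ?thesis"
      then have le: "q (Suc 0) \<le> s" using J(1)[of 0] i by simp
      \<comment> \<open>\<open>Y 0\<close> does contain \<open>q 0\<close>, so here the gap is used
        upwards, to reach \<open>q (m - 1)\<close>.\<close>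
      have "q (Suc (Suc 0)) < s" using far[OF L1 s(1) le i] .
      moreover have "q (m - 1) \<le> n"
        using wrap mono[of 0 "m - 1"] top[OF s(1)] m early_range[OF s(1)] J_in[OF Y, of "m - 2"] J(1)[of "m - 2"]
          edge_subset[OF Y, of "m - 2"] by (auto simp: numeral_2_eq_2 Suc_diff_Suc)
      ultimately have "q (m - 1) \<in> Y 0"
        using arc_above_gap[OF Y gap(2)[OF i] s(2) gap(1)[OF i], of "q (m - 1)"]
          mono[of "Suc 0" "Suc (Suc 0)"] i top[OF s(1)] by auto
      then show False using only[of 0 "m - 1"] m by auto
    qed
  qed
  then have "available E M (S (Y 0)) (q 0)" using J_available[OF L] J(2) available_mono by metis
  moreover have "q 0 \<in> Y 0" using seg[of 0] mono[of 0 1] m by auto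
  ultimately have "J (Y 0) \<le> q 0" by (intro J_le)
  then show False using J(1)[of 0] mono[of 0 1] m by auto
qed

end

section \<open>Acyclicity of the least source\<close>

text \<open>The last two assumptions are the closure and fix conditions on all restrictions, rephrased
  in terms of membership.\<close>

locale closed_source_bound = source_bound +
  assumes bound_attained:
    "G \<in> E \<Longrightarrow> \<exists>A. A \<in> acyclic_orientations E \<and> (\<forall>H\<in>E. A H \<le> M H) \<and> A G = M G"
    and interval_closed:
    "K \<in> E \<Longrightarrow> K' \<in> E \<Longrightarrow> x \<in> K - K' \<Longrightarrow> y \<in> K' - K \<Longrightarrow> x + 1 < y \<Longrightarrow>
       {x<..<y} \<subseteq> K \<inter> K' \<Longrightarrow> {x<..<y} \<in> E"
    and hugging_fix:
    "I \<in> E \<Longrightarrow> I' \<in> E \<Longrightarrow> F \<in> E \<Longrightarrow> F' \<in> E \<Longrightarrow> x < y \<Longrightarrow>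
       {x, x + 1} \<subseteq> I \<Longrightarrow> y \<notin> I \<Longrightarrow> {x, x + 1, y} \<subseteq> I' \<Longrightarrow> y - 1 \<notin> I' \<Longrightarrow>
       {y - 1, y} \<subseteq> F \<Longrightarrow> x \<notin> F \<Longrightarrow> {x, y - 1, y} \<subseteq> F' \<Longrightarrow> x + 1 \<notin> F' \<Longrightarrow>
       \<exists>K\<in>E. {x + 1, y - 1} \<subseteq> K \<and> K \<inter> {x..y} \<subseteq> I \<union> I' \<union> F \<union> F'"
begin

text \<open>The orientations in which contradictory cycles will be found. Only values on
  \<open>E\<close> matter, so extensionality is dropped.\<close>

definition below_bound :: "(nat set \<Rightarrow> nat) \<Rightarrow> bool" where
  "below_bound A \<longleftrightarrow> acyclic (precedence E A) \<and> (\<forall>H\<in>E. A H \<in> H \<and> A H \<le> M H)"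

lemma ex_below_bound:
  assumes "G \<in> E" obtains A where "below_bound A" "A G = M G"
  using bound_attained[OF assms] that
  unfolding below_bound_def acyclic_orientations_iff orientations_def by blast

lemma below_bound_acyclic: "below_bound A \<Longrightarrow> acyclic (precedence E A)"
  and below_bound_in: "below_bound A \<Longrightarrow> H \<in> E \<Longrightarrow> A H \<in> H"
  and below_bound_le: "below_bound A \<Longrightarrow> H \<in> E \<Longrightarrow> A H \<le> M H"
  unfolding below_bound_def by auto

lemma below_bound_le_J: "below_bound A \<Longrightarrow> H \<in> E \<Longrightarrow> A H \<le> J H"
  using below_bound_le bound_le_J order_trans by blast

text \<open>Extend the segment down to the last vertex \<open>x\<close> missed by \<open>G\<close>
  and up to the first vertex \<open>y\<close> missed by \<open>H\<close>. If \<open>G\<close>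
  reaches \<open>y\<close>, the open interval between them is a hyperedge inside \<open>H\<close>,
  so its bound is at most \<open>J H\<close>, whereas \<open>A\<close> gives it the source
  \<open>M G\<close>. Otherwise \<open>G\<close> is contained in \<open>H\<close>, and
  \<open>M G \<le> J H\<close>.\<close>

lemma no_common_segment:
  assumes H: "H \<in> E" and G: "G \<in> E" and A: "below_bound A" "A G = M G" and lt: "J H < M G"
    and GH: "{J H..M G} \<subseteq> G \<inter> H" and s: "s \<notin> H" "M G < s" "s \<le> n"
  shows False
proof -
  define a where "a = J H"
  define e where "e = M G"
  have a: "a \<in> H" "a \<in> G" and e: "e \<in> H" "e \<in> G" "a < e"
    using GH lt unfolding a_def e_def by auto
  have AH: "A H \<in> H" "A H \<le> a" using below_bound_in below_bound_le_J A H unfolding a_def by auto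
  have AHG: "A H \<notin> G"
    using acyclic_no_2_cycle[OF below_bound_acyclic[OF A(1)] H G] A(2) AH e unfolding e_def by auto
  have AH1: "1 \<le> A H" using AH(1) edge_subset[OF H] by auto
  \<comment> \<open>\<open>A H\<close> belongs to this set, as otherwise \<open>H\<close> and
    \<open>G\<close> form a cycle of \<open>A\<close>. It also ensures that \<open>H\<close> reaches
    down to \<open>x\<close>.\<close>
  define x where "x = Max {v. v \<le> a \<and> v \<notin> G}"
  have fin: "finite {v. v \<le> a \<and> v \<notin> G}" by simp
  have "x \<in> {v. v \<le> a \<and> v \<notin> G}" unfolding x_def using AHG AH by (intro Max_in fin) auto
  then have x: "x < a" "x \<notin> G" using a by (auto simp: order.strict_iff_order)
  have xAH: "A H \<le> x" unfolding x_def using AHG AH by (intro Max_ge fin) auto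
  have xG: "v \<in> G" if "x < v" "v \<le> a" for v
    using Max_ge[OF fin, of v] that leD unfolding x_def by blast
  have xH: "v \<in> H" if "x \<le> v" "v \<le> a" for v
    using arc_between[OF H AH(1) a(1), of v s] that xAH s e AH1 AH(2) unfolding e_def by auto
  define y where "y = (LEAST v. e < v \<and> v \<notin> H)"
  have y: "e < y" "y \<notin> H" unfolding y_def using LeastI[of "\<lambda>v. e < v \<and> v \<notin> H" s] s unfolding e_def by auto
  have ys: "y \<le> s" unfolding y_def using s unfolding e_def by (intro Least_le) auto
  have yH: "v \<in> H" if "a \<le> v" "v < y" for v
  proof (cases "v \<le> e")
    case True
    then show ?thesis using GH that unfolding a_def e_def by auto
  next
    case False
    then show ?thesis using not_less_Least[of v "\<lambda>v. e < v \<and> v \<notin> H"] that unfolding y_def by auto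
  qed
  have xyH: "{x<..<y} \<subseteq> H"
  proof
    fix v assume "v \<in> {x<..<y}"
    then show "v \<in> H" using xH[of v] yH[of v] by (cases "v \<le> a") auto
  qed
  show False
  proof (cases "{a..y} \<subseteq> G")
    case True
    have xyG: "{x<..<y} \<subseteq> G"
    proof
      fix v assume "v \<in> {x<..<y}"
      then show "v \<in> G" using xG[of v] True by (cases "v \<le> a") auto
    qed
    have "y \<in> G" using True e y by (simp add: subset_iff)
    then have L: "{x<..<y} \<in> E"
      using interval_closed[OF H G, of x y] xyH xyG xH[of x] x y e by auto
    have aL: "a \<in> {x<..<y}" and eL: "e \<in> {x<..<y}" using x e y by auto
    have "M {x<..<y} \<le> a"
      using bound_le_J_of_subset[OF H L _ xyH] aL unfolding a_def by simp
    moreover have "A {x<..<y} = A G"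
      by (rule acyclic_no_2_cycle[OF below_bound_acyclic[OF A(1)] L G])
        (use below_bound_in[OF A(1) L] xyG A(2) eL in \<open>auto simp: e_def\<close>)
    ultimately show False using below_bound_le[OF A(1) L] A(2) e unfolding e_def by simp
  next
    case False
    then obtain y' where y': "a \<le> y'" "y' \<le> y" "y' \<notin> G" by (auto simp: subset_iff)
    have ey': "e < y'" using y' GH unfolding a_def e_def by (meson IntD1 atLeastAtMost_iff not_le subsetD)
    \<comment> \<open>\<open>G\<close> misses a vertex on either side of the segment and, being an
      arc, stays between them.\<close>
    have "G \<subseteq> {x<..<y'}"
    proof
      fix w assume w: "w \<in> G"
      have "\<not> w < x"
        using arc_above_gap[OF G w a(2) x(2), of y'] x y' ys s by auto
      moreover have "\<not> y' < w"
        using arc_below_gap[OF G e(2) w y'(3) ey', of x] x AH1 xAH e by auto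
      ultimately show "w \<in> {x<..<y'}" using w x y' by (metis greaterThanLessThan_iff linorder_neqE_nat)
    qed
    also have "{x<..<y'} \<subseteq> {x<..<y}" using y' by auto
    finally have "G \<subseteq> H" using xyH by blast
    then have "M G \<le> a" using bound_le_J_of_subset[OF H G] a unfolding a_def by simp
    then show False using e unfolding e_def by simp
  qed
qed

text \<open>Some \<open>blocking\<close> hyperedge keeps \<open>a = J H\<close> from being available
  for \<open>H'\<close>. It wraps around and belongs to a hugging quadruple with fix
  \<open>K'\<close>. For an acyclic \<open>A\<close> below \<open>M\<close> with
  \<open>A G = M G\<close>, the source \<open>A K'\<close> then has no possible place.\<close>

lemma no_2_cycle:
  assumes H: "H \<in> E" and H': "H' \<in> E" and lt: "J H < J H'" and aH': "J H \<in> H'" and bH: "J H' \<in> H"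
  shows False
proof -
  define a where "a = J H"
  define b where "b = J H'"
  have ab: "a < b" and a: "a \<in> H" "a \<in> H'" and b: "b \<in> H" "b \<in> H'"
    using lt aH' bH J_in[OF H] J_in[OF H'] unfolding a_def b_def by auto
  have a1: "1 \<le> a" and bn: "b \<le> n" using a b edge_range[OF H] by auto
  have nav: "\<not> available E M (S H') a" using J_le[OF a(2)] ab unfolding b_def by auto
  then have "\<not> S H \<subseteq> S H'" using J_available[OF H] available_mono unfolding a_def by blast
  \<comment> \<open>The listing for \<open>H\<close> enters \<open>H'\<close> at \<open>s\<close>,
    not below \<open>b\<close>. As \<open>s\<close> lies outside \<open>H\<close>, it forces
    \<open>H\<close> to contain the segment from \<open>a\<close> to \<open>b\<close>.\<close>
  then obtain s where s: "s \<in> S H" "s \<in> H'" "\<not> s < b"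
    using early_subset[of H H'] unfolding b_def by blast
  have sH: "s \<notin> H" and sn: "s \<le> n" using early_not_in[OF s(1)] early_range[OF s(1)] by auto
  then have bs: "b < s" using s(3) b by (metis linorder_neqE_nat)
  have Hseg: "v \<in> H" if "a \<le> v" "v \<le> b" for v
    using arc_between[OF H a(1) b(1) that sH] bs sn by simp
  define blocking where "blocking G \<longleftrightarrow> G \<in> E \<and> a \<in> G \<and> a < M G \<and> G \<inter> S H' = {}" for G
  \<comment> \<open>Without wrapping, \<open>G\<close> would share the segment from \<open>a\<close>
    to \<open>M G\<close> with \<open>H\<close>, against \<open>no_common_segment\<close>. Cycles of
    \<open>A\<close> of length two and three then keep \<open>M G\<close> out of \<open>H\<close>
    and \<open>H'\<close>.\<close>
  have shape: "\<exists>A. below_bound A \<and> A G = M G \<and> A H \<in> G \<and> b \<notin> G \<and> b < M G \<and> M G \<notin> H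
      \<and> M G \<notin> H' \<and> {1..a} \<subseteq> G \<and> {M G..n} \<subseteq> G" if "blocking G" for G
  proof -
    have G: "G \<in> E" "a \<in> G" "a < M G" "G \<inter> S H' = {}" using that unfolding blocking_def by auto
    define e where "e = M G"
    have e: "e \<in> G" "a < e" "e \<le> n"
      using bound_in[OF G(1)] edge_range[OF G(1)] G(3) unfolding e_def by auto
    obtain A where A: "below_bound A" "A G = e" unfolding e_def by (rule ex_below_bound[OF G(1)])
    note ac = below_bound_acyclic[OF A(1)]
    have AH: "A H \<in> H" "A H \<le> a" using below_bound_in below_bound_le_J A H unfolding a_def by auto
    have AH': "A H' \<in> H'" "A H' \<le> b" using below_bound_in below_bound_le_J A H' unfolding b_def by auto
    have be: "e \<le> b" if "b \<in> G"
      using bound_le_J_of_disjoint[OF H' G(1) _ G(4)] that unfolding b_def e_def by simp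
    have "\<not> {a..e} \<subseteq> G"
    proof
      assume sub: "{a..e} \<subseteq> G"
      have "b \<in> G" if "b \<le> e" using sub ab that by (simp add: subset_iff)
      then have "e \<le> b" using be by linarith
      then have "{a..e} \<subseteq> H" using Hseg by auto
      with no_common_segment[OF H G(1) A(1), of s] sub sH sn A(2) e \<open>e \<le> b\<close> bs
      show False unfolding a_def e_def by auto
    qed
    then obtain v where v: "v \<notin> G" "a < v" "v < e" using G(2) e(1)
      by (metis atLeastAtMost_iff order_le_less subsetI)
    have low: "{1..a} \<subseteq> G" using arc_below_gap[OF G(1,2) e(1) v] by auto
    have up: "{e..n} \<subseteq> G" using arc_above_gap[OF G(1,2) e(1) v] by auto
    have AHG: "A H \<in> G" using subsetD[OF low, of "A H"] AH edge_range[OF H] by simp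
    have eH: "e \<notin> H" using acyclic_no_2_cycle[OF ac H G(1) AHG] A(2) AH e by auto
    then have "\<not> e \<le> b" using Hseg e by auto
    then have "b < e" "b \<notin> G" using be by auto
    moreover have "e \<notin> H'"
    proof
      assume eH': "e \<in> H'"
      have "A H' \<notin> G"
        using acyclic_no_2_cycle[OF ac H' G(1)] A(2) AH' eH' \<open>b < e\<close> by auto
      then have "a < A H'" using subsetD[OF low, of "A H'"] AH' edge_range[OF H'] by force
      then have "A H' \<in> H" using Hseg AH' by auto
      then show False using acyclic_no_3_cycle[OF ac H G(1) H' AHG] A(2) eH' AH e by auto
    qed
    ultimately show ?thesis using A low up AHG eH unfolding e_def by blast
  qed
  have ex: "\<exists>G. blocking G" 
  proof -
    obtain G where "G \<in> E" "a \<in> G" "\<not> M G \<le> a" "G \<inter> S H' = {}"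
      using nav unfolding available_def by blast
    then show ?thesis unfolding blocking_def by (intro exI[of _ G]) simp
  qed
  \<comment> \<open>No bound exceeds \<open>n\<close>, so \<open>n\<close> is available and can only
    remain unlisted by lying in \<open>H'\<close>.\<close>
  have H'n: "n \<in> H'"
  proof -
    obtain G where G: "blocking G" using ex by blast
    have "M G \<le> n" using G edge_range[OF _ bound_in] unfolding blocking_def by simp
    then have "n \<in> G" using shape[OF G] by auto
    then have "n \<notin> S H'" using G unfolding blocking_def by blast
    moreover have "available E M (S H') n"
      unfolding available_def using edge_range[OF _ bound_in] by simp
    ultimately show ?thesis using a1 ab bn by (simp add: early_iff)
  qed

  \<comment> \<open>\<open>G\<close> is chosen with \<open>g\<close> as large as possible, then with \<open>e = M G\<close> as large as possible: the first
    choice excludes the fix from blocking, the second keeps \<open>g\<close> out of the hyperedge \<open>F\<close> below.\<close>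
  define Pg where "Pg = {v. a \<le> v \<and> v < b \<and> (\<exists>G. blocking G \<and> v \<in> G)}"
  have "a \<in> Pg" using ex ab unfolding Pg_def blocking_def by auto
  moreover have finPg: "finite Pg" unfolding Pg_def by (rule finite_subset[of _ "{..<b}"]) auto
  ultimately have "Max Pg \<in> Pg" by (intro Max_in) auto
  then obtain g G0 where g: "g = Max Pg" "a \<le> g" "g < b" and G0: "blocking G0" "g \<in> G0"
    unfolding Pg_def by blast
  have gmax: "v \<le> g" if "blocking X" "v \<in> X" "v < b" for X v
  proof (cases "a \<le> v")
    case True
    then have "v \<in> Pg" using that unfolding Pg_def by auto
    then show ?thesis unfolding g using finPg by simp
  qed (use g in simp)
  define Pe where "Pe = {M G | G. blocking G \<and> g \<in> G}"
  have finPe: "finite Pe" unfolding Pe_def blocking_def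
    by (rule finite_subset[of _ "{1..n}"]) (use bound_in edge_subset in blast, simp)
  have "Max Pe \<in> Pe" using G0 finPe unfolding Pe_def by (intro Max_in) auto
  then obtain G where G: "blocking G" "g \<in> G" and MaxPe: "Max Pe = M G" unfolding Pe_def by blast
  define e where "e = M G"
  have emax: "M X \<le> e" if "blocking X" "g \<in> X" for X
  proof -
    have "M X \<in> Pe" using that unfolding Pe_def by blast
    then show ?thesis using finPe MaxPe unfolding e_def by (metis Max_ge)
  qed
  have GE: "G \<in> E" and aG: "a \<in> G" and GS: "G \<inter> S H' = {}" using G unfolding blocking_def by auto
  obtain A where A: "below_bound A" "A G = e" and AHG: "A H \<in> G" and bG: "b \<notin> G" and be: "b < e"
    and eH: "e \<notin> H" and eH': "e \<notin> H'" and low: "{1..a} \<subseteq> G" and up: "{e..n} \<subseteq> G"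
    using shape[OF G(1)] unfolding e_def by blast
  note ac = below_bound_acyclic[OF A(1)]
  have eG: "e \<in> G" and en: "e < n"
  proof -
    show "e \<in> G" using bound_in[OF GE] unfolding e_def .
    then have "e \<le> n" using edge_range[OF GE] by simp
    then show "e < n" using eH' H'n by (metis order_le_less)
  qed
  have g1G: "g + 1 \<notin> G" using gmax[OF G(1), of "g + 1"] bG g by (cases "g + 1 = b") auto
  have H'low: "v \<in> H'" if "1 \<le> v" "v \<le> b" for v
    using arc_below_gap[OF H' b(2) H'n eH' be en that] .
  have lowG: "v \<in> G" if "1 \<le> v" "v \<le> a" for v using low that by auto
  have upG: "v \<in> G" if "e \<le> v" "v \<le> n" for v using up that by auto
  have SH': "b < v \<and> v < e" if "v \<in> S H'" for v
  proof -
    have "v \<notin> H'" "1 \<le> v" "v \<le> n" "v \<notin> G"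
      using early_not_in[OF that] early_range[OF that] GS that by auto
    then show ?thesis using H'low[of v] upG[of v] by linarith
  qed
  have "\<exists>w. w \<in> G \<and> w \<in> S H"
    using J_available[OF H] GE aG G(1) unfolding available_def a_def blocking_def by auto
  then obtain t where t: "t \<in> S H" "t \<in> G" "e \<le> t"
    unfolding e_def using early_hit[OF GE] by blast
  \<comment> \<open>The maximum ensures \<open>z \<in> H'\<close>: a hyperedge keeping
    \<open>z\<close> out of \<open>S H'\<close> would be met by \<open>S H\<close> at a larger
    vertex, again in \<open>G\<close>.\<close>
  define z where "z = Max (S H \<inter> G)"
  have finz: "finite (S H \<inter> G)" using finite_subset[OF edge_subset[OF GE]] by simp
  have z: "z \<in> S H" "z \<in> G" unfolding z_def using Max_in[OF finz] t by auto
  have ez: "e \<le> z" using Max_ge[OF finz, of t] t unfolding z_def by auto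
  have zH: "z \<notin> H" and zn: "1 \<le> z" "z \<le> n" using early_not_in[OF z(1)] early_range[OF z(1)] by auto
  have zH': "z \<in> H'"
  proof (rule ccontr)
    assume "z \<notin> H'"
    moreover have "z \<notin> S H'" using z GS by blast
    ultimately have "\<not> available E M (S H') z" using zn by (simp add: early_iff)
    then obtain F where F: "F \<in> E" "z \<in> F" "\<not> M F \<le> z" unfolding available_def by blast
    obtain w where "w \<in> S H" "w \<in> F" "M F \<le> w" using early_hit[OF F(1) z(1) F(2)] by blast
    then have "w \<in> S H \<inter> G" "z < w" using F upG[of w] ez early_range[of w] by auto
    then show False using Max_ge[OF finz, of w] unfolding z_def by auto
  qed
  then have ez: "e < z" using ez eH' by (metis order_le_less)

  \<comment> \<open>Quadruple on \<open>{g..y}\<close>: \<open>H\<close>, \<open>F\<close> regular and \<open>K\<close>, \<open>G\<close> cyclic. Taking \<open>y\<close> minimal over all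
    candidates for \<open>K\<close> forces every fix to contain \<open>e\<close>.\<close>
  define wide where
    "wide K \<longleftrightarrow> K \<in> E \<and> {g, g + 1, n} \<subseteq> K \<and> e \<notin> K \<and> K \<inter> S H' \<subseteq> H" for K
  define Py where "Py y \<longleftrightarrow> e < y \<and> (\<exists>K. wide K \<and> y \<in> K)" for y
  have gH': "wide H'"
    unfolding wide_def using H' H'low[of g] H'low[of "g + 1"] H'n eH' g a1 early_not_in[of _ H'] by auto
  then have Pz: "Py z" unfolding Py_def using zH' ez by blast
  define y where "y = (LEAST y. Py y)"
  have Py: "Py y" unfolding y_def using Pz by (rule LeastI)
  have yz: "y \<le> z" unfolding y_def using Pz by (rule Least_le)
  have ymin: "\<not> Py v" if "v < y" for v using that not_less_Least unfolding y_def by blast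
  from Py obtain K where ey: "e < y" and K: "wide K" "y \<in> K" unfolding Py_def by blast
  have KE: "K \<in> E" using K unfolding wide_def by blast
  have yn: "y \<le> n" using yz zn by simp
  \<comment> \<open>Minimality of \<open>y\<close> says nothing about \<open>y - 1 = e\<close>;
    there \<open>wide\<close> itself excludes membership.\<close>
  have pred_out: "y - 1 \<notin> X" if "wide X" for X
    using ymin[of "y - 1"] that ey unfolding Py_def wide_def by (cases "y - 1 = e") auto
  have y1G: "y - 1 \<in> G" "y \<in> G" using upG[of y] upG[of "y - 1"] ey yn by auto
  \<comment> \<open>The hyperedge \<open>F\<close> that keeps \<open>y - 1\<close> from being listed
    for \<open>H'\<close> serves as the regular hyperedge at the upper end.\<close>
  have "y - 1 \<notin> H'" "y - 1 \<notin> S H'" using pred_out[OF gH'] GS y1G by auto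
  then have "\<not> available E M (S H') (y - 1)" using ey yn be ab a1 by (simp add: early_iff)
  then obtain F where F: "F \<in> E" "y - 1 \<in> F" "\<not> M F \<le> y - 1" "F \<inter> S H' = {}"
    unfolding available_def by blast
  have MF: "y \<le> M F" using F(3) by simp
  have bF: "b \<notin> F"
    using bound_le_J_of_disjoint[OF H' F(1) _ F(4)] MF ey be unfolding b_def by auto
  have b1: "1 \<le> b" using a1 ab by simp
  have yF: "y \<in> F"
    using arc_between[OF F(1,2) bound_in[OF F(1)], of y b] bF MF ey be b1 bn by auto
  have gF: "g \<notin> F"
  proof
    assume "g \<in> F"
    moreover from this have "a \<in> F"
      using arc_below_gap[OF F(1) _ F(2) bF, of g a] g a1 ey be by auto
    ultimately show False
      using emax[of F] F MF ey be ab unfolding blocking_def by auto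
  qed
  have yH: "y \<notin> H"
  proof
    assume "y \<in> H"
    then have "z \<in> H" using arc_above_gap[OF H a(1) _ eH, of y z] be ab ey yz zn by auto
    then show False using zH by simp
  qed
  have "\<exists>K'\<in>E. {g + 1, y - 1} \<subseteq> K' \<and> K' \<inter> {g..y} \<subseteq> H \<union> K \<union> F \<union> G"
    by (rule hugging_fix[OF H KE F(1) GE])
      (use g Hseg yH K pred_out[OF K(1)] F(2) yF gF G(2) y1G g1G ey be in \<open>auto simp: wide_def\<close>)
  then obtain K' where K': "K' \<in> E" "g + 1 \<in> K'" "y - 1 \<in> K'" "K' \<inter> {g..y} \<subseteq> H \<union> K \<union> F \<union> G" by auto
  have K'S: "K' \<inter> S H' \<subseteq> H"
  proof
    fix v assume v: "v \<in> K' \<inter> S H'"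
    then have "v \<in> {g..y}" using SH'[of v] g ey by auto
    then have "v \<in> H \<union> K \<union> F \<union> G" using K'(4) v by blast
    then show "v \<in> H" using v GS F(4) K(1) unfolding wide_def by blast
  qed
  have g1: "1 \<le> g" "g + 1 \<le> b" using g a1 by auto
  have eK': "e \<in> K'"
  proof (rule ccontr)
    assume e: "e \<notin> K'"
    then have lt: "g + 1 < e" "e < y - 1" using g1 be ey K'(3) by (auto simp: order.strict_iff_order)
    have "g \<in> K'" using arc_below_gap[OF K'(1,2,3) e lt, of g] g1 by simp
    moreover have "n \<in> K'" using arc_above_gap[OF K'(1,2,3) e lt, of n] yn by simp
    ultimately have "wide K'" unfolding wide_def using K' e K'S by auto
    then show False using pred_out[of K'] K' by blast
  qed
  have AH: "A H \<le> a" using below_bound_le_J A H unfolding a_def by auto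
  have AK': "A K' \<in> K'" "A K' \<le> M K'" using below_bound_in below_bound_le A K' by auto
  have AK'_G: "A K' = e" if "A K' \<in> G"
    using acyclic_no_2_cycle[OF ac K'(1) GE that] A(2) eK' by simp
  have AK'_H: "A K' \<notin> H" using acyclic_no_3_cycle[OF ac H GE K'(1) AHG] A(2) AH eK' be ab by auto
  have above: "a < A K'" if "A K' < e"
    using AK'_G lowG[of "A K'"] that AK'(1) edge_range[OF K'(1)] by force
  \<comment> \<open>Below \<open>e\<close>, the source \<open>A K'\<close> must exceed
    \<open>a\<close> and avoid \<open>H\<close>. Either the bound \<open>M K'\<close> leaves no such
    vertex, or \<open>K'\<close> is blocking and contradicts the choice of \<open>g\<close>.\<close>
  show False
  proof (cases "K' \<inter> S H' = {}")
    case True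
    show False
    proof (cases "b \<in> K'")
      case b: True
      have "M K' \<le> b" using bound_le_J_of_disjoint[OF H' K'(1) _ True] b unfolding b_def by simp
      then show False using AK' AK'_H above Hseg be by auto
    next
      case False
      then have g1b: "g + 1 < b" using g1 K'(2) by (metis order_le_less)
      have "a \<in> K'" using arc_below_gap[OF K'(1,2) eK' False g1b be, of a] a1 g by simp
      then have "blocking K' \<or> M K' \<le> a" using K' True unfolding blocking_def by auto
      then show False
      proof
        assume "blocking K'"
        then show False using gmax[OF _ K'(2) g1b] by simp
      next
        assume "M K' \<le> a"
        then show False using above AK' be ab by auto
      qed
    qed
  next
    case False
    then obtain t where t: "t \<in> S H'" "t \<in> K'" "M K' \<le> t" using early_hit[OF K'(1)] by blast
    have tH: "t \<in> H" using K'S t by auto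
    have te: "t < e" using SH'[OF t(1)] by simp
    then have "a < A K'" using above AK' t by auto
    then show False using arc_between[OF H a(1) tH, of "A K'" z] AK' AK'_H t te ez zn zH by auto
  qed
qed

text \<open>Some \<open>G\<close> keeps \<open>q 0\<close> from being available for the wrapping
  hyperedge; let \<open>A G = M G\<close>. Along the cycle, \<open>A\<close> puts
  \<open>A (Y 0)\<close> weakly before all vertices from \<open>q 0\<close> to \<open>q r\<close>.
  If \<open>G\<close> wraps, it contains \<open>A (Y 0)\<close> and closes a cycle of
  \<open>A\<close>. Otherwise \<open>M G\<close> lies in a segment of the cycle, where
  \<open>no_common_segment\<close> or a cycle of length two applies.\<close>

lemma no_ascending_winding_cycle:
  assumes m: "3 \<le> m" and Y: "\<And>i. i < m \<Longrightarrow> Y i \<in> E"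
    and mono: "\<And>i j. i < j \<Longrightarrow> j < m \<Longrightarrow> q i < q j"
    and seg: "\<And>i. Suc i < m \<Longrightarrow> {q i..q (Suc i)} \<subseteq> Y i"
    and wrap: "{1..q 0} \<union> {q (m - 1)..n} \<subseteq> Y (m - 1)"
    and only: "\<And>i j. i < m \<Longrightarrow> j < m \<Longrightarrow> q j \<in> Y i \<Longrightarrow> j = i \<or> j = Suc i \<or> (Suc i = m \<and> j = 0)"
    and J: "\<And>i. i < m \<Longrightarrow> J (Y i) = q i"
  shows False
proof -
  let ?L = "Y (m - 1)"
  have L: "?L \<in> E" and JL: "J ?L = q (m - 1)" and Y0: "Y 0 \<in> E" using m by (auto intro!: Y J)
  have qY: "q i \<in> Y i" if "i < m" for i using J_in[OF Y] J that by metis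
  have q_range: "1 \<le> q i" "q i \<le> n" if "i < m" for i using edge_range[OF Y qY] that by auto
  have q0L: "q 0 \<in> ?L" using wrap q_range[of 0] m by auto
  have "\<not> available E M (S ?L) (q 0)"
    using J_le[OF q0L] mono[of 0 "m - 1"] m JL by auto
  then obtain G where G: "G \<in> E" "q 0 \<in> G" "\<not> M G \<le> q 0" "G \<inter> S ?L = {}"
    unfolding available_def by blast
  define e where "e = M G"
  have e: "e \<in> G" "q 0 < e" "e \<le> n" using bound_in[OF G(1)] edge_range[OF G(1)] G(3) unfolding e_def by auto
  obtain A where A: "below_bound A" "A G = e" unfolding e_def by (rule ex_below_bound[OF G(1)])
  note ac = below_bound_acyclic[OF A(1)]
  have AY: "A (Y i) \<in> Y i" "A (Y i) \<le> q i" if "i < m" for i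
    using below_bound_in[OF A(1) Y[OF that]] below_bound_le_J[OF A(1) Y[OF that]] J[OF that] by auto
  \<comment> \<open>\<open>Y i\<close> misses \<open>q 0\<close>, so a source below
    \<open>q 0\<close> forces it to continue from \<open>q i\<close> up to \<open>n\<close>.\<close>
  have wraps: "v \<in> Y i" if "i < m" "A (Y i) < q 0" "1 \<le> i" "i \<noteq> m - 1" "q i \<le> v" "v \<le> n" for i v
  proof -
    have "q 0 \<notin> Y i" using only[of i 0] that by auto
    then show ?thesis
      using arc_above_gap[OF Y[of i] AY(1)[of i] qY[of i], of "q 0" v] mono[of 0 i] that by auto
  qed
  \<comment> \<open>If the source of \<open>Y (m - 2)\<close> under \<open>A\<close> lies beyond the cut between \<open>n\<close> and \<open>1\<close>, then \<open>Y (m - 2)\<close>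
    takes over the role of the wrapping hyperedge \<open>Y (m - 1)\<close>.\<close>
  obtain r where r: "1 \<le> r" "r < m"
    and up: "\<And>v. q r \<le> v \<Longrightarrow> v \<le> n \<Longrightarrow> v \<in> Y r"
    and dis: "G \<inter> S (Y r) = {}"
    and low: "\<And>i. 1 \<le> i \<Longrightarrow> i < r \<Longrightarrow> q 0 \<le> A (Y i)"
  proof (cases "A (Y (m - 2)) < q 0")
    case True
    have up: "v \<in> Y (m - 2)" if "q (m - 2) \<le> v" "v \<le> n" for v
      using wraps[of "m - 2" v] True m that by auto
    have "S (Y (m - 2)) \<subseteq> S ?L"
    proof (rule early_subset)
      fix s assume s: "s \<in> S (Y (m - 2))"
      then have "\<not> q (m - 2) \<le> s" using up[of s] early_not_in[OF s] early_range[OF s] by auto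
      moreover have "q (m - 2) < q (m - 1)" using m by (intro mono) auto
      ultimately show "s < J ?L" unfolding JL by linarith
    qed
    then have "G \<inter> S (Y (m - 2)) = {}" using G(4) by blast
    moreover have "q 0 \<le> A (Y i)" if "1 \<le> i" "i < m - 2" for i
    proof (rule ccontr)
      assume "\<not> ?thesis"
      moreover have "i < m" "i < m - 1" "i \<noteq> m - 1" using that by auto
      ultimately have "q (m - 1) \<in> Y i"
        using wraps[of i "q (m - 1)"] mono[of i "m - 1"] q_range[of "m - 1"] that(1) m by auto
      then have "m - 1 = i \<or> m - 1 = Suc i" using only[of i "m - 1"] that m by auto
      then show False using that m by linarith
    qed
    ultimately show thesis using that[of "m - 2"] up m by auto
  next
    case False
    have "q 0 \<le> A (Y i)" if "1 \<le> i" "i < m - 1" for i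
    proof (rule ccontr)
      assume lt: "\<not> ?thesis"
      then have "q (m - 1) \<in> Y i"
        using wraps[of i "q (m - 1)"] mono[of i "m - 1"] q_range[of "m - 1"] that m by auto
      then have "i = m - 2" using only[of i "m - 1"] that by auto
      then show False using lt False by simp
    qed
    moreover have "v \<in> ?L" if "q (m - 1) \<le> v" "v \<le> n" for v using wrap that by auto
    ultimately show thesis using that[of "m - 1"] G(4) m by auto
  qed
  have er: "e \<le> q r" if "q r \<in> G"
    using bound_le_J_of_disjoint[OF Y[OF r(2)] G(1) _ dis] that J[OF r(2)] unfolding e_def by simp
  have in_seg: "v \<in> Y i" if "Suc i < m" "q i \<le> v" "v \<le> q (Suc i)" for i v
    using seg[OF that(1)] that by auto
  let ?R = "precedence E A"
  have AY_le: "(A (Y i), v) \<in> ?R\<^sup>*" if "i < m" "v \<in> Y i" for i v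
    using precedenceI[of "Y i" E v A] Y that by (cases "v = A (Y i)") auto
  \<comment> \<open>For \<open>1 \<le> i < r\<close> the source \<open>A (Y i)\<close> lies between
    \<open>q 0\<close> and \<open>q i\<close>, where the induction hypothesis applies, and
    \<open>Y i\<close> leads on to \<open>v\<close>.\<close>
  have descend: "(A (Y 0), v) \<in> ?R\<^sup>*" if "i \<le> r" "q 0 \<le> v" "v \<le> q i" for i v
    using that
  proof (induction i arbitrary: v)
    case 0
    then show ?case using AY_le[of 0 v] qY[of 0] m by auto
  next
    case (Suc i)
    show ?case
    proof (cases "v \<le> q i")
      case True
      then show ?thesis using Suc by auto
    next
      case False
      then have v: "v \<in> Y i" using in_seg[of i v] Suc.prems r by auto
      then have *: "(A (Y i), v) \<in> ?R\<^sup>*" using AY_le[of i v] Suc.prems r by auto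
      show ?thesis
      proof (cases "i = 0")
        case False
        then have "(A (Y 0), A (Y i)) \<in> ?R\<^sup>*"
          using Suc.IH[of "A (Y i)"] low[of i] AY(2)[of i] Suc.prems r by auto
        with * show ?thesis by auto
      qed (use * in simp)
    qed
  qed
  have AY0: "A (Y 0) \<le> q 0" using AY(2)[of 0] m by auto
  show False
  proof (cases "{q 0..e} \<subseteq> G")
    case True
    have "e \<le> q r"
    proof (rule ccontr)
      assume "\<not> ?thesis"
      moreover from this have "q r \<in> {q 0..e}" using mono[of 0 r] r by auto
      ultimately show False using er subsetD[OF True] by blast
    qed
    \<comment> \<open>A discrete intermediate value argument locates the segment containing
      \<open>e\<close>.\<close>
    have "e \<le> q i \<longrightarrow> i \<le> r \<longrightarrow> (\<exists>j<i. q j < e \<and> e \<le> q (Suc j))" for i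
    proof (induction i)
      case (Suc i)
      then show ?case by (cases "e \<le> q i") (auto intro: less_SucI)
    qed (use e in auto)
    then obtain i where i: "i < r" "q i < e" "e \<le> q (Suc i)" using \<open>e \<le> q r\<close> by blast
    then have eY: "e \<in> Y i" using in_seg[of i e] r by auto
    have im: "i < m" using i r by simp
    show False
    proof (cases "i = 0")
      case True
      have "{q 0..e} \<subseteq> Y 0" using in_seg[of 0] i r True by auto
      moreover have "q (m - 1) \<notin> Y 0" using only[of 0 "m - 1"] m by auto
      moreover have "q (Suc 0) < q (m - 1)" using m by (intro mono) auto
      then have "e < q (m - 1)" using i True by simp
      ultimately show False
        using no_common_segment[OF Y0 G(1) A(1), of "q (m - 1)"] \<open>{q 0..e} \<subseteq> G\<close> A(2) e J[of 0] q_range[of "m - 1"] m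
        unfolding e_def by auto
    next
      case False
      then have "q 0 \<le> A (Y i)" using low i by auto
      then have "A (Y i) \<in> G" using True AY(2)[OF im] i by auto
      then have "A (Y i) = e" using acyclic_no_2_cycle[OF ac Y[OF im] G(1)] A(2) eY by simp
      then show False using AY(2)[OF im] i by simp
    qed
  next
    case False
    then obtain v where v: "v \<notin> G" "q 0 < v" "v < e" using G(2) e(1)
      by (metis atLeastAtMost_iff order_le_less subsetI)
    have lowG: "u \<in> G" if "1 \<le> u" "u \<le> q 0" for u
      using arc_below_gap[OF G(1,2) e(1) v that] .
    have "A (Y 0) \<in> G" using lowG[of "A (Y 0)"] AY0 edge_range[OF Y0 AY(1)] m by auto
    then have return: "(e, A (Y 0)) \<in> ?R"
      using precedenceI[of G E "A (Y 0)" A] G(1) A(2) AY0 e by auto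
    have "(A (Y 0), e) \<in> ?R\<^sup>*"
    proof (cases "e \<le> q r")
      case True
      then show ?thesis using descend[of r e] e by auto
    next
      case False
      then have eY: "e \<in> Y r" using up e by auto
      have "\<not> A (Y r) < q 0"
      proof
        assume "A (Y r) < q 0"
        then have "A (Y r) \<in> G" using lowG[of "A (Y r)"] edge_range[OF Y AY(1)] r by auto
        then have "A (Y r) = e" using acyclic_no_2_cycle[OF ac Y[OF r(2)] G(1)] A(2) eY by simp
        then show False using AY(2)[OF r(2)] False by simp
      qed
      then have "(A (Y 0), A (Y r)) \<in> ?R\<^sup>*" using descend[of r "A (Y r)"] AY(2)[OF r(2)] by auto
      then show ?thesis using AY_le[OF r(2) eY] by auto
    qed
    with return have "(e, e) \<in> ?R\<^sup>+" by auto
    then show False using ac unfolding acyclic_def by blast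
  qed
qed

text \<open>Take a shortest cycle and start it at its least vertex. It has no chords and no
  repetitions, so from length three on it winds around the circle, in one direction or the
  other.\<close>

theorem J_acyclic: "acyclic (precedence E J)"
proof (rule ccontr)
  let ?R = "precedence E J"
  assume "\<not> ?thesis"
  then obtain u where "(u, u) \<in> ?R\<^sup>+" unfolding acyclic_def by blast
  then have ex: "\<exists>k>0. \<exists>v. (v, v) \<in> ?R ^^ k" by (auto simp: trancl_power)
  define m where "m = (LEAST k. k > 0 \<and> (\<exists>v. (v, v) \<in> ?R ^^ k))"
  have m: "m > 0" "\<exists>v. (v, v) \<in> ?R ^^ m" using LeastI_ex[OF ex] unfolding m_def by auto
  have m_le: "m \<le> k" if "k > 0" "(v, v) \<in> ?R ^^ k" for k v
    unfolding m_def using that by (intro Least_le) auto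
  define v where "v = (LEAST v. (v, v) \<in> ?R ^^ m)"
  have "(v, v) \<in> ?R ^^ m" unfolding v_def using m(2) by (rule LeastI_ex)
  then obtain f where f: "f 0 = v" "f m = v" "\<And>i. i < m \<Longrightarrow> (f i, f (Suc i)) \<in> ?R"
    by (auto simp: relpow_fun_conv)
  have path: "(f i, f (i + l)) \<in> ?R ^^ l" if "i + l \<le> m" for i l
    using that
  proof (induction l)
    case (Suc l)
    then show ?case using f(3)[of "i + l"] by (auto intro!: relpow_Suc_I)
  qed simp
  have join: "(x, z) \<in> ?R ^^ (k + l)" if "(x, y) \<in> ?R ^^ k" "(y, z) \<in> ?R ^^ l" for x y z k l
    using that unfolding relpow_add by blast
  have fmin: "v \<le> f i" if "i \<le> m" for i
  proof -
    have "(f i, f i) \<in> ?R ^^ (m - i + i)"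
      using path[of i "m - i"] path[of 0 i] f that by (intro join[of _ v]) auto
    then have "(f i, f i) \<in> ?R ^^ m" using that by simp
    then show ?thesis unfolding v_def by (rule Least_le)
  qed
  \<comment> \<open>Any other precedence closes a shorter cycle: directly if it leads back, through
    \<open>v\<close> if it leads forward.\<close>
  have chord: "j = Suc i \<or> (Suc i = m \<and> j = 0)" if ij: "i < m" "j < m" and R: "(f i, f j) \<in> ?R" for i j
  proof (cases "j \<le> i")
    case True
    have "(f j, f j) \<in> ?R ^^ (i - j + 1)"
      using path[of j "i - j"] R True ij by (intro join[of _ "f i"]) auto
    then have "m \<le> i - j + 1" by (intro m_le) auto
    then show ?thesis using ij True by auto
  next
    case False
    have "(v, f j) \<in> ?R ^^ (i + 1)" using path[of 0 i] R ij f by (intro join[of _ "f i"]) auto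
    moreover have "(f j, v) \<in> ?R ^^ (m - j)" using path[of j "m - j"] ij f by simp
    ultimately have "(v, v) \<in> ?R ^^ (i + 1 + (m - j))" by (rule join)
    then have "m \<le> i + 1 + (m - j)" by (intro m_le) auto
    then show ?thesis using ij False by auto
  qed
  have inj: "f i \<noteq> f j" if "i < j" "j < m" for i j
  proof
    assume "f i = f j"
    then have "(f i, f i) \<in> ?R ^^ (j - i)" using path[of i "j - i"] that by auto
    then have "m \<le> j - i" using that by (intro m_le) auto
    then show False using that by auto
  qed
  have "\<exists>X. X \<in> E \<and> J X = f i \<and> f (Suc i) \<in> X" if "i < m" for i
    using f(3)[OF that] by (auto elim!: precedenceE)
  then obtain X where X: "\<And>i. i < m \<Longrightarrow> X i \<in> E" "\<And>i. i < m \<Longrightarrow> J (X i) = f i"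
      "\<And>i. i < m \<Longrightarrow> f (Suc i) \<in> X i" by metis
  have fX: "f i \<in> X i" if "i < m" for i using J_in[OF X(1)] X(2) that by metis
  have only: "j = i \<or> j = Suc i \<or> (Suc i = m \<and> j = 0)" if "i < m" "j < m" "f j \<in> X i" for i j
  proof (cases "f j = f i")
    case True
    then show ?thesis using inj that by (metis linorder_neqE_nat)
  next
    case False
    then have "(f i, f j) \<in> ?R" using precedenceI[of "X i" E "f j" J] X that by simp
    then show ?thesis using chord that by blast
  qed
  have m3: "3 \<le> m"
  proof (rule ccontr)
    assume "\<not> ?thesis"
    then consider "m = 1" | "m = 2" using m by linarith
    then show False
    proof cases
      case 1
      then have "(v, v) \<in> ?R" using f by force
      then show False by (auto elim: precedenceE)
    next
      case 2
      then have "J (X 0) = f 0" "J (X 1) = f 1" "f 1 \<in> X 0" "f 0 \<in> X 1" "X 0 \<in> E" "X 1 \<in> E" "f 0 \<noteq> f 1"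
        using X(1,2)[of 0] X(1,2)[of 1] X(3)[of 0] X(3)[of 1] f(1,2) inj[of 0 1] by (auto simp: numeral_2_eq_2)
      then show False using no_2_cycle[of "X 0" "X 1"] no_2_cycle[of "X 1" "X 0"] by (metis linorder_neqE_nat)
    qed
  qed
  have f0: "f 0 < f j" if "0 < j" "j < m" for j
    using fmin[of j] f(1) inj[OF that] that by auto
  have f0_last: "f 0 \<in> X (m - 1)" using X(3)[of "m - 1"] f(1,2) m3 by auto
  have "f 1 \<noteq> f (m - 1)" using inj[of 1 "m - 1"] m3 by auto
  then consider "f 1 < f (m - 1)" | "f (m - 1) < f 1" by linarith
  then show False
  proof cases
    case 1
    have X3: "f (Suc i) \<in> X i" if "Suc i < m" for i using X(3) that by auto
    note sh = winding_cycle_shape[OF m3 X(1) fX X3 f0_last only f0 inj 1]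
    show False by (rule no_ascending_winding_cycle[OF m3 X(1) sh only X(2)])
  next
    case 2
    \<comment> \<open>Reversed traversal, with \<open>q 0 = f m = f 0\<close>. The shift in
      \<open>Y\<close> makes \<open>Y i\<close> join \<open>q i\<close> to \<open>q (Suc i)\<close>,
      and its source is now the latter, or \<open>q 0\<close> for the last hyperedge.\<close>
    define q where "q i = f (m - i)" for i
    define Y where "Y i = X (m - Suc i)" for i
    have Y: "Y i \<in> E" if "i < m" for i unfolding Y_def using X(1) m3 by auto
    have Suc_diff: "Suc (m - Suc i) = m - i" if "i < m" for i using that by auto
    have q_this: "q i \<in> Y i" if "i < m" for i
      unfolding q_def Y_def using X(3)[of "m - Suc i"] that by (simp add: Suc_diff)
    have q_next: "q (Suc i) \<in> Y i" if "Suc i < m" for i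
      unfolding q_def Y_def using fX that by auto
    have q0: "q 0 = f 0" unfolding q_def using f by simp
    have q_last: "q 0 \<in> Y (m - 1)" unfolding q0 Y_def using fX[of 0] m3 by simp
    have q_only: "j = i \<or> j = Suc i \<or> (Suc i = m \<and> j = 0)" if "i < m" "j < m" "q j \<in> Y i" for i j
    proof (cases "j = 0")
      case True
      then show ?thesis using only[of "m - Suc i" 0] that q0 unfolding Y_def by auto
    next
      case False
      then show ?thesis using only[of "m - Suc i" "m - j"] that unfolding Y_def q_def by auto
    qed
    have q_min: "q 0 < q j" if "0 < j" "j < m" for j
      unfolding q0 using f0[of "m - j"] that unfolding q_def by simp
    have q_inj: "q i \<noteq> q j" if "i < j" "j < m" for i j
    proof (cases "i = 0")
      case False
      then have "m - j < m - i" "m - i < m" using that by auto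
      then show ?thesis using inj[of "m - j" "m - i"] unfolding q_def by auto
    qed (use q_min[of j] that in auto)
    have q_dir: "q 1 < q (m - 1)" unfolding q_def using 2 m3 by simp
    have JY: "J (Y i) = q (Suc i)" if "Suc i < m" for i
      unfolding Y_def q_def using X(2) that by simp
    have JY_last: "J (Y (m - 1)) = q 0" unfolding Y_def q0 using X(2)[of 0] m3 by simp
    note sh = winding_cycle_shape[OF m3 Y q_this q_next q_last q_only q_min q_inj q_dir]
    show False by (rule no_descending_winding_cycle[OF m3 Y sh q_only JY JY_last])
  qed
qed

end

section \<open>The lattice property\<close>

lemma cyclic_interval_hypergraph_arc:
  assumes "cyclic_interval_hypergraph 1 n E" "H \<in> E" "u \<in> H" "w \<in> H" "u < w"
  shows "{u..w} \<subseteq> H \<or> {1..u} \<union> {w..n} \<subseteq> H"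
proof -
  have "(\<exists>v. H = {v}) \<or> regular_interval 1 n H \<or> cyclic_interval 1 n H"
    using assms(1,2) by (simp add: cyclic_interval_hypergraph_def)
  then show ?thesis
  proof (elim disjE exE)
    fix v assume "H = {v}"
    then show ?thesis using assms(3-5) by simp
  next
    assume "regular_interval 1 n H"
    then obtain i j where "H = {i..j}" unfolding regular_interval_def by blast
    then show ?thesis using assms(3,4) by simp
  next
    assume "cyclic_interval 1 n H"
    then obtain i j where ij: "i < j" "H = {j..n} \<union> {1..i}" and "j \<le> n" unfolding cyclic_interval_def by blast
    have u: "1 \<le> u" "j \<le> u \<or> u \<le> i" and w: "w \<le> n" "j \<le> w \<or> w \<le> i"
      using assms(3-5) ij \<open>j \<le> n\<close> by auto
    then consider "j \<le> u" | "w \<le> i" | "u \<le> i" "j \<le> w" by blast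
    then show ?thesis
    proof cases
      case 1
      then have "{u..w} \<subseteq> {j..n}" using w by simp
      then show ?thesis unfolding ij(2) by (simp add: le_supI1)
    next
      case 2
      then have "{u..w} \<subseteq> {1..i}" using u by simp
      then show ?thesis unfolding ij(2) by (simp add: le_supI2)
    next
      case 3
      then have "{1..u} \<subseteq> {1..i}" "{w..n} \<subseteq> {j..n}" by auto
      then show ?thesis unfolding ij(2) by blast
    qed
  qed
qed

section \<open>Traces on an interval and the two conditions in terms of membership\<close>

lemma trace_shape:
  assumes "cyclic_interval_hypergraph 1 n E" "1 \<le> x" "y \<le> n" "H \<in> E" "u \<in> H \<inter> {x..y}" "v \<in> H \<inter> {x..y}" "u \<noteq> v"
  shows "H \<inter> {x..y} \<in> restriction E {x..y}"
    and "regular_interval x y (H \<inter> {x..y}) \<or> cyclic_interval x y (H \<inter> {x..y})"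
proof -
  show r: "H \<inter> {x..y} \<in> restriction E {x..y}" using assms unfolding restriction_def by blast
  have "\<not> (\<exists>w. H \<inter> {x..y} = {w})" using assms(5,6,7) by (metis singletonD)
  then show "regular_interval x y (H \<inter> {x..y}) \<or> cyclic_interval x y (H \<inter> {x..y})"
    using restriction_cyclic_interval_hypergraph[OF assms(1-3)] r
    unfolding cyclic_interval_hypergraph_def by blast
qed

text \<open>A cyclic interval contains both endpoints, and two distinct vertices exclude a
  singleton.\<close>

lemma trace_regular:
  assumes "cyclic_interval_hypergraph 1 n E" "1 \<le> x" "y \<le> n" "H \<in> E" "u \<in> H \<inter> {x..y}" "v \<in> H \<inter> {x..y}" "u \<noteq> v"
    and "x \<notin> H \<or> y \<notin> H"
  shows "H \<inter> {x..y} \<in> regular_hyperedges x y (restriction E {x..y})"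
proof -
  have "\<not> cyclic_interval x y (H \<inter> {x..y})"
  proof
    assume "cyclic_interval x y (H \<inter> {x..y})"
    then obtain i j where "x \<le> i" "j \<le> y" "H \<inter> {x..y} = {j..y} \<union> {x..i}"
      unfolding cyclic_interval_def by blast
    then have "x \<in> H \<inter> {x..y}" "y \<in> H \<inter> {x..y}" by auto
    then show False using assms(8) by blast
  qed
  then show ?thesis using trace_shape[OF assms(1-7)] unfolding regular_hyperedges_def by blast
qed

lemma trace_cyclic:
  assumes "cyclic_interval_hypergraph 1 n E" "1 \<le> x" "y \<le> n" "H \<in> E"
    and "x \<in> H" "y \<in> H" "w \<notin> H" "x < w" "w < y"
  shows "H \<inter> {x..y} \<in> cyclic_hyperedges x y (restriction E {x..y})"
proof -
  have mem: "x \<in> H \<inter> {x..y}" "y \<in> H \<inter> {x..y}" "w \<notin> H \<inter> {x..y}" "x \<noteq> y" using assms by auto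
  have "\<not> regular_interval x y (H \<inter> {x..y})"
  proof
    assume "regular_interval x y (H \<inter> {x..y})"
    then obtain i j where "H \<inter> {x..y} = {i..j}" unfolding regular_interval_def by blast
    then show False using mem assms(8,9) by auto
  qed
  then show ?thesis using trace_shape[OF assms(1-4) mem(1,2,4)] unfolding cyclic_hyperedges_def by blast
qed

locale lattice_conditions =
  fixes n :: nat and E :: "nat set set"
  assumes cyc: "cyclic_interval_hypergraph 1 n E"
    and closed: "\<And>x y. 1 \<le> x \<Longrightarrow> x < y \<Longrightarrow> y \<le> n \<Longrightarrow>
      regular_closed_under_intersection x y (restriction E {x..y})"
    and fixes_exist: "\<And>x y I Icyc J Jcyc. 1 \<le> x \<Longrightarrow> x < y \<Longrightarrow> y \<le> n \<Longrightarrow>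
      hugging_quadruple x y (restriction E {x..y}) I Icyc J Jcyc \<Longrightarrow>
      \<exists>K. is_fix x y (restriction E {x..y}) I Icyc J Jcyc K"
begin

sublocale arc_hypergraph n E
proof unfold_locales
  have "hypergraph_on 1 n E" using cyc by (simp add: cyclic_interval_hypergraph_def)
  then show "H \<subseteq> {1..n}" "H \<noteq> {}" if "H \<in> E" for H
    using that by (simp_all add: hypergraph_on_def)
qed (rule cyclic_interval_hypergraph_arc[OF cyc])

text \<open>Both traces on \<open>{x..y}\<close> miss an endpoint, so they are regular, and they
  meet exactly in the open interval. A hyperedge \<open>L\<close> with this trace misses
  \<open>x\<close> and \<open>y\<close>, so as an arc it cannot continue outside.\<close>

lemma interval_closed:
  assumes K: "K \<in> E" "K' \<in> E" and x: "x \<in> K - K'" and y: "y \<in> K' - K" and xy: "x + 1 < y"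
    and sub: "{x<..<y} \<subseteq> K \<inter> K'"
  shows "{x<..<y} \<in> E"
proof -
  have r: "1 \<le> x" "x < y" "y \<le> n" using edge_range[OF K(1), of x] edge_range[OF K(2), of y] x y xy by auto
  have xy': "x + 1 \<in> {x<..<y}" using xy by auto
  have x1: "x + 1 \<in> K" "x + 1 \<in> K'" using sub xy' by auto
  have 1: "K \<inter> {x..y} \<in> regular_hyperedges x y (restriction E {x..y})"
    by (rule trace_regular[OF cyc r(1,3) K(1), of x "x + 1"]) (use x x1 y xy in simp_all)
  have 2: "K' \<inter> {x..y} \<in> regular_hyperedges x y (restriction E {x..y})"
    by (rule trace_regular[OF cyc r(1,3) K(2), of y "x + 1"]) (use x x1 y xy in simp_all)
  have eq: "(K \<inter> {x..y}) \<inter> (K' \<inter> {x..y}) = {x<..<y}"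
  proof
    show "(K \<inter> {x..y}) \<inter> (K' \<inter> {x..y}) \<subseteq> {x<..<y}"
    proof
      fix w assume "w \<in> (K \<inter> {x..y}) \<inter> (K' \<inter> {x..y})"
      moreover from this have "w \<noteq> x" "w \<noteq> y" using x y by blast+
      ultimately show "w \<in> {x<..<y}" by simp
    qed
    have "{x<..<y} \<subseteq> {x..y}" by auto
    then show "{x<..<y} \<subseteq> (K \<inter> {x..y}) \<inter> (K' \<inter> {x..y})" using sub by blast
  qed
  have "{x<..<y} \<in> restriction E {x..y}"
    using closed[OF r] 1 2 eq xy' unfolding regular_closed_under_intersection_def by (metis empty_iff)
  then obtain L where L: "L \<in> E" "L \<inter> {x..y} = {x<..<y}" unfolding restriction_def by auto
  have xL: "x \<notin> L" and yL: "y \<notin> L" and x1L: "x + 1 \<in> L" using L(2) xy xy' by auto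
  have "L \<subseteq> {x..y}"
  proof
    fix w assume w: "w \<in> L"
    have "\<not> w < x" using arc_above_gap[OF L(1) w x1L xL, of y] yL xy r by auto
    moreover have "\<not> y < w" using arc_below_gap[OF L(1) x1L w yL xy, of x] xL r by auto
    ultimately show "w \<in> {x..y}" by auto
  qed
  then show ?thesis using L by (simp add: Int_absorb2)
qed

text \<open>The missed endpoints make the traces of \<open>I\<close> and \<open>F\<close> regular,
  the missed neighbours \<open>y - 1\<close> and \<open>x + 1\<close> make those of
  \<open>I'\<close> and \<open>F'\<close> cyclic, and together they tell the four traces apart. A
  fix is the trace of some hyperedge.\<close>

lemma hugging_fix:
  assumes "I \<in> E" "I' \<in> E" "F \<in> E" "F' \<in> E" "x < y"
    and I: "{x, x + 1} \<subseteq> I" "y \<notin> I" and I': "{x, x + 1, y} \<subseteq> I'" "y - 1 \<notin> I'"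
    and F: "{y - 1, y} \<subseteq> F" "x \<notin> F" and F': "{x, y - 1, y} \<subseteq> F'" "x + 1 \<notin> F'"
  shows "\<exists>K\<in>E. {x + 1, y - 1} \<subseteq> K \<and> K \<inter> {x..y} \<subseteq> I \<union> I' \<union> F \<union> F'"
proof -
  let ?D = "{x..y}"
  have r: "1 \<le> x" "y \<le> n" using edge_range[OF assms(1)] edge_range[OF assms(3)] I F by auto
  have ne: "x + 1 \<noteq> y" "x \<noteq> y - 1" using I F by auto
  have ne': "x + 1 \<noteq> y - 1" using I' by auto
  have "hugging_quadruple x y (restriction E ?D) (I \<inter> ?D) (I' \<inter> ?D) (F \<inter> ?D) (F' \<inter> ?D)"
    unfolding hugging_quadruple_def
  proof (intro conjI)
    show "I \<inter> ?D \<in> regular_hyperedges x y (restriction E ?D)"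
      using trace_regular[OF cyc r assms(1), of x "x + 1"] I \<open>x < y\<close> by auto
    show "F \<inter> ?D \<in> regular_hyperedges x y (restriction E ?D)"
      using trace_regular[OF cyc r assms(3), of "y - 1" y] F \<open>x < y\<close> by auto
    show "I' \<inter> ?D \<in> cyclic_hyperedges x y (restriction E ?D)"
      using trace_cyclic[OF cyc r assms(2), of "y - 1"] I' \<open>x < y\<close> ne by auto
    show "F' \<inter> ?D \<in> cyclic_hyperedges x y (restriction E ?D)"
      using trace_cyclic[OF cyc r assms(4), of "x + 1"] F' \<open>x < y\<close> ne by auto
    have mem: "x \<in> ?D" "y \<in> ?D" "x + 1 \<in> ?D" "y - 1 \<in> ?D" using \<open>x < y\<close> by auto
    have "I \<inter> ?D \<noteq> I' \<inter> ?D" "I \<inter> ?D \<noteq> F \<inter> ?D" "I \<inter> ?D \<noteq> F' \<inter> ?D" "I' \<inter> ?D \<noteq> F \<inter> ?D"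
      "I' \<inter> ?D \<noteq> F' \<inter> ?D" "F \<inter> ?D \<noteq> F' \<inter> ?D"
      using mem I I' F F' by blast+
    then show "distinct [I \<inter> ?D, I' \<inter> ?D, F \<inter> ?D, F' \<inter> ?D]" by simp
    show "{x, x + 1} \<subseteq> (I \<inter> ?D) \<inter> (I' \<inter> ?D)" "{y - 1, y} \<subseteq> (F \<inter> ?D) \<inter> (F' \<inter> ?D)"
      using mem I I' F F' by auto
  qed
  then obtain K where K: "is_fix x y (restriction E ?D) (I \<inter> ?D) (I' \<inter> ?D) (F \<inter> ?D) (F' \<inter> ?D) K"
    using fixes_exist[OF r(1) assms(5) r(2)] by blast
  then obtain L where "L \<in> E" "K = L \<inter> ?D" unfolding is_fix_def restriction_def by blast
  then show ?thesis using K unfolding is_fix_def by (intro bexI[of _ L]) auto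
qed

section \<open>Joins of sets, the least element and the lattice\<close>

lemma finite_edges: "finite E"
  using edge_subset by (intro finite_subset[of E "Pow {1..n}"]) auto

lemma finite_acyclic_orientations: "finite (acyclic_orientations E)"
proof -
  have "finite (orientations E)" unfolding orientations_def
    using finite_edges edge_subset by (intro finite_PiE) (auto intro: finite_subset)
  then show ?thesis unfolding acyclic_orientations_def by simp
qed

text \<open>The pointwise maximum \<open>M\<close> is attained in \<A> at every hyperedge, so
  \<open>J\<close> is acyclic, and it is the least upper bound. Arbitrary nonempty sets are treated
  because meets will be joins of sets of lower bounds.\<close>

lemma ex_join:
  assumes sub: "\<A> \<subseteq> acyclic_orientations E" and ne: "\<A> \<noteq> {}"
  shows "\<exists>B \<in> acyclic_orientations E. (\<forall>A\<in>\<A>. \<forall>H\<in>E. A H \<le> B H) \<and>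
    (\<forall>C \<in> acyclic_orientations E. (\<forall>A\<in>\<A>. \<forall>H\<in>E. A H \<le> C H) \<longrightarrow> (\<forall>H\<in>E. B H \<le> C H))"
proof -
  have fin: "finite \<A>" using finite_subset[OF sub finite_acyclic_orientations] .
  define M where "M H = Max ((\<lambda>A. A H) ` \<A>)" for H
  have M_ge: "A H \<le> M H" if "A \<in> \<A>" for A H unfolding M_def using fin that by simp
  have M_at: "\<exists>A\<in>\<A>. A H = M H" for H
  proof -
    have "M H \<in> (\<lambda>A. A H) ` \<A>" unfolding M_def using fin ne by (intro Max_in) auto
    then show ?thesis by auto
  qed
  have inH: "A H \<in> H" if "A \<in> acyclic_orientations E" "H \<in> E" for A H
    using that unfolding acyclic_orientations_def orientations_def by auto
  interpret closed_source_bound n E M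
  proof unfold_locales
    show "M G \<in> G" if "G \<in> E" for G using M_at[of G] inH that sub by force
    show "\<exists>A. A \<in> acyclic_orientations E \<and> (\<forall>H\<in>E. A H \<le> M H) \<and> A G = M G" if "G \<in> E" for G
      using M_at[of G] M_ge sub by blast
  qed (fact interval_closed hugging_fix)+
  \<comment> \<open>Restriction gives the extensional representative without changing the
    precedences.\<close>
  define B where "B = restrict J E"
  have "precedence E B = precedence E J" unfolding precedence_def B_def by auto
  then have "B \<in> acyclic_orientations E"
    using J_acyclic J_in unfolding acyclic_orientations_iff orientations_def B_def by auto
  moreover have "\<forall>A\<in>\<A>. \<forall>H\<in>E. A H \<le> B H"
    using M_ge bound_le_J order_trans unfolding B_def by fastforce
  moreover have "\<forall>H\<in>E. B H \<le> C H"
    if C: "C \<in> acyclic_orientations E" "\<forall>A\<in>\<A>. \<forall>H\<in>E. A H \<le> C H" for C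
  proof
    fix H assume H: "H \<in> E"
    have "M G \<le> C G" if "G \<in> E" for G using M_at[of G] C(2) that by metis
    then show "B H \<le> C H" using J_least[OF C(1) _ H] H unfolding B_def by simp
  qed
  ultimately show ?thesis by blast
qed

text \<open>If every source is a minimum, all precedences increase strictly. The least element makes
  sets of lower bounds nonempty.\<close>

lemma ex_bottom: "\<exists>A \<in> acyclic_orientations E. \<forall>B \<in> acyclic_orientations E. \<forall>H\<in>E. A H \<le> B H"
proof -
  define A where "A = (\<lambda>H\<in>E. Min H)"
  have fin: "finite H" if "H \<in> E" for H using finite_subset[OF edge_subset[OF that]] by simp
  have "precedence E A \<subseteq> {(v, w). v < w}"
  proof
    fix p assume "p \<in> precedence E A"
    then obtain H w where "p = (A H, w)" "H \<in> E" "w \<in> H" "w \<noteq> A H" unfolding precedence_def by blast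
    then show "p \<in> {(v, w). v < w}" using Min_le[OF fin] unfolding A_def by (auto simp: order.strict_iff_order)
  qed
  then have "acyclic (precedence E A)"
    by (rule acyclic_subset[rotated]) (rule wf_acyclic[OF wf_less])
  then have "A \<in> acyclic_orientations E"
    unfolding acyclic_orientations_iff orientations_def A_def using fin edge_nonempty by auto
  moreover have "A H \<le> B H" if "B \<in> acyclic_orientations E" "H \<in> E" for B H
  proof -
    have "B H \<in> H" using that unfolding acyclic_orientations_def orientations_def by blast
    then show ?thesis using Min_le[OF fin] that(2) unfolding A_def by simp
  qed
  ultimately show ?thesis by blast
qed

lemma hypergraphic_poset_lattice: "lattice (hypergraphic_poset E)"
proof -
  let ?P = "hypergraphic_poset E"
  have carr: "carrier ?P = acyclic_orientations E"
    and le: "A \<sqsubseteq>\<^bsub>?P\<^esub> B \<longleftrightarrow> (\<forall>H\<in>E. A H \<le> B H)" and eq: "A .=\<^bsub>?P\<^esub> B \<longleftrightarrow> A = B" for A B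
    unfolding hypergraphic_poset_def by auto
  have po: "partial_order ?P"
  proof unfold_locales
    fix A B assume "A \<sqsubseteq>\<^bsub>?P\<^esub> B" "B \<sqsubseteq>\<^bsub>?P\<^esub> A" "A \<in> carrier ?P" "B \<in> carrier ?P"
    then have "A \<in> (\<Pi>\<^sub>E H\<in>E. H)" "B \<in> (\<Pi>\<^sub>E H\<in>E. H)" "\<forall>H\<in>E. A H \<le> B H" "\<forall>H\<in>E. B H \<le> A H"
      unfolding carr le acyclic_orientations_def orientations_def by simp_all
    then have "A = B" by (intro PiE_ext[of A E "\<lambda>H. H"]) (auto intro: antisym)
    then show "A .=\<^bsub>?P\<^esub> B" unfolding eq .
  next
    show "(.=\<^bsub>?P\<^esub>) = (=)" by (intro ext) (simp add: eq)
  qed (auto simp: carr le eq intro: order_trans)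
  interpret partial_order ?P by (rule po)
  show ?thesis
  proof unfold_locales
    fix A B assume AB: "A \<in> carrier ?P" "B \<in> carrier ?P"
    then have "{A, B} \<subseteq> acyclic_orientations E" "{A, B} \<noteq> {}" unfolding carr by auto
    from ex_join[OF this] show "\<exists>s. least ?P s (Upper ?P {A, B})"
      unfolding least_def Upper_def carr le using AB carr by auto
    let ?L = "{C \<in> acyclic_orientations E. \<forall>H\<in>E. C H \<le> A H \<and> C H \<le> B H}"
    have "?L \<noteq> {}" using ex_bottom AB unfolding carr by blast
    then obtain C where "C \<in> acyclic_orientations E" "\<forall>D\<in>?L. \<forall>H\<in>E. D H \<le> C H"
      "\<forall>D \<in> acyclic_orientations E. (\<forall>A\<in>?L. \<forall>H\<in>E. A H \<le> D H) \<longrightarrow> (\<forall>H\<in>E. C H \<le> D H)"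
      using ex_join[of ?L] by blast
    then have "greatest ?P C (Lower ?P {A, B})"
      unfolding greatest_def Lower_def carr le using AB carr by auto
    then show "\<exists>s. greatest ?P s (Lower ?P {A, B})" by blast
  qed
qed

end

theorem theorem5p12:
  fixes n :: nat and \<H> :: "nat set set"
  assumes "cyclic_interval_hypergraph 1 n \<H>"
    and "\<And>x y. 1 \<le> x \<Longrightarrow> x < y \<Longrightarrow> y \<le> n \<Longrightarrow>
           regular_closed_under_intersection x y (restriction \<H> {x..y})"
    and "\<And>x y I Icyc J Jcyc. 1 \<le> x \<Longrightarrow> x < y \<Longrightarrow> y \<le> n \<Longrightarrow>
           hugging_quadruple x y (restriction \<H> {x..y}) I Icyc J Jcyc \<Longrightarrow>
           \<exists>K. is_fix x y (restriction \<H> {x..y}) I Icyc J Jcyc K"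
  shows "lattice (hypergraphic_poset \<H>)"
proof -
  interpret lattice_conditions n \<H> by unfold_locales (fact assms)+
  show ?thesis by (rule hypergraphic_poset_lattice)
qed

end
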